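(* Let $m$ be an integer, and let $\sigma$ be a measure on $\mathbb{R}^+$ such that $\sigma(\{0\})=0$. Let $\mathcal{T}$ be a linear operator satisfying all of the following assumptions: (i) $\mathcal{T}$ maps $L^p(\mathbb{R}^+,r^{m-1}dr)$ to $L^q(\mathbb{R}^+,\sigma)$ (boundedly) with $1<p<q<\infty$, and $\mathcal{T}$ maps the Lorentz space $L^{p,p+\delta}(\mathbb{R}^+,r^{m-1}dr)$ to the Lorentz space $L^{q,q-\delta}(\mathbb{R}^+,\sigma)$ (boundedly) for some $\delta>0$ such that $p+\delta<q-\delta$; (ii) $\mathcal{T}$ satisfies the rearrangement inequality $\|\mathcal{T}f\|_q\le\|\mathcal{T}(f^* )\|_q$, where $f^*$ denotes the (radial) nonincreasing rearrangement of $f$ with respect to $r^{m-1}dr$; (iii) for any nonnegative, nonincreasing function $f$, $\mathcal{T}f$ is also nonincreasing; (iv) the inequality $$\|\mathcal{T}f\|_q\le A\|f\|_p\qquad ( * )$$ is invariant under the standard action of dilations. Then the inequality $( * )$ admits nonincreasing, radial extremizers. Moreover, any extremizing sequence of decreasing functions is relatively compact modulo the group of dilations.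
   Context: $\mathbb{R}^+=(0,\infty)$. $\|\cdot\|_p$ and $\|\cdot\|_q$ are the norms of $L^p(\mathbb{R}^+,r^{m-1}dr)$ and $L^q(\mathbb{R}^+,\sigma)$, and $A$ is the optimal constant in $( * )$. A radial function is identified with a function of the norm, i.e. a function on $\mathbb{R}^+$. For a measure space $(X,\nu)$, $1\le p<\infty$ and $1\le r<\infty$, the Lorentz space $L^{p,r}(X,\nu)$ is the space of measurable $f$ with finite quasi-norm $$\|f\|_{L^{p,r}}=\left(\int_0^\infty\big(d_f(t)^{1/p}\,t\big)^r\frac{dt}{t}\right)^{1/r},\qquad d_f(t)=\nu(\{x:|f(x)|\ge t\}).$$ The nonincreasing rearrangement $f^*$ of $f$ with respect to $\mu=r^{m-1}dr$ is the nonincreasing function $f^*:\mathbb{R}^+\to[0,\infty]$ such that, for every $t>0$, $\{f^*\ge t\}$ is (up to null sets) the interval starting at $0$ with the same $\mu$-measure as $\{|f|\ge t\}$. Dilations act by $f\mapsto f_\lambda$, $f_\lambda(r)=\lambda^{m/p}f(\lambda r)$, $\lambda>0$, which preserves $\|f\|_p$; invariance of $( * )$ means $\|\mathcal{T}f_\lambda\|_q=\|\mathcal{T}f\|_q$ for all $\lambda>0$ and $f\in L^p(\mathbb{R}^+,r^{m-1}dr)$. An extremizer for $( * )$ is a nonzero $f\in L^p$ with $\|\mathcal{T}f\|_q=A\|f\|_p$. An extremizing sequence is a sequence $(f_n)$ with $\|f_n\|_p=1$ for all $n$ and $\|\mathcal{T}f_n\|_q\to A$. Relatively compact modulo the group of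 dilations means that there exist $\lambda_n>0$ such that the sequence $r\mapsto\lambda_n^{m/p}f_n(\lambda_n r)$ admits a subsequence converging in $L^p(\mathbb{R}^+,r^{m-1}dr)$.
   Formalization: The relative compactness of extremizing sequences of decreasing functions is stated only for optimal constant A > 0; for T = 0 every normalized decreasing sequence is extremizing and the claim fails (two bubbles at separating scales). *)

theory Defs
  imports "HOL-Analysis.Analysis"
begin

text \<open>Functions on $(0,\infty)$ are represented by total functions on the reals; their values
  outside the space of the measure at hand play no role. Elements of $L^p$ and Lorentz spaces are
  represented by functions, so that identities between them are required almost everywhere only.\<close>

definition radial_measure :: "int \<Rightarrow> real measure" where
  "radial_measure m = density (restrict_space lborel {0<..}) (\<lambda>r. ennreal (r powi (m - 1)))"

definition Lp_space :: "real measure \<Rightarrow> real \<Rightarrow> (real \<Rightarrow> real) set" where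
  "Lp_space M p = {f \<in> borel_measurable M. integrable M (\<lambda>x. \<bar>f x\<bar> powr p)}"

definition Lp_norm :: "real measure \<Rightarrow> real \<Rightarrow> (real \<Rightarrow> real) \<Rightarrow> real" where
  "Lp_norm M p f = (\<integral>x. \<bar>f x\<bar> powr p \<partial>M) powr (1 / p)"

text \<open>Real powers on $[0,\infty]$, used with positive exponents only, so that the value at infinity
  is infinity.\<close>

definition ennpowr :: "ennreal \<Rightarrow> real \<Rightarrow> ennreal" where
  "ennpowr x a = (if x = \<infinity> then \<infinity> else ennreal (enn2real x powr a))"

definition distr_fun :: "real measure \<Rightarrow> (real \<Rightarrow> real) \<Rightarrow> real \<Rightarrow> ennreal" where
  "distr_fun M f t = emeasure M {x \<in> space M. t \<le> \<bar>f x\<bar>}"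

definition lorentz_ennnorm :: "real measure \<Rightarrow> real \<Rightarrow> real \<Rightarrow> (real \<Rightarrow> real) \<Rightarrow> ennreal" where
  "lorentz_ennnorm M p s f =
     ennpowr (\<integral>\<^sup>+t\<in>{0<..}. ennpowr (ennpowr (distr_fun M f t) (1 / p) * ennreal t) s / ennreal t \<partial>lborel)
       (1 / s)"

definition lorentz_space :: "real measure \<Rightarrow> real \<Rightarrow> real \<Rightarrow> (real \<Rightarrow> real) set" where
  "lorentz_space M p s = {f \<in> borel_measurable M. lorentz_ennnorm M p s f < \<infinity>}"

definition lorentz_norm :: "real measure \<Rightarrow> real \<Rightarrow> real \<Rightarrow> (real \<Rightarrow> real) \<Rightarrow> real" where
  "lorentz_norm M p s f = enn2real (lorentz_ennnorm M p s f)"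

text \<open>A bounded linear operator from the function space \<open>X\<close> to the function space \<open>Y\<close>, whose
  elements are taken modulo null sets of \<open>N\<close>. Linearity and boundedness imply that functions
  equal almost everywhere have images equal almost everywhere.\<close>

definition bounded_linear_op ::
  "(real \<Rightarrow> real) set \<Rightarrow> ((real \<Rightarrow> real) \<Rightarrow> real) \<Rightarrow>
   (real \<Rightarrow> real) set \<Rightarrow> ((real \<Rightarrow> real) \<Rightarrow> real) \<Rightarrow>
   real measure \<Rightarrow> ((real \<Rightarrow> real) \<Rightarrow> real \<Rightarrow> real) \<Rightarrow> bool" where
  "bounded_linear_op X normX Y normY N T \<longleftrightarrow>
     (\<forall>f\<in>X. \<forall>g\<in>X. \<forall>a b. AE x in N. T (\<lambda>r. a * f r + b * g r) x = a * T f x + b * T g x) \<and>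
     (\<exists>C. \<forall>f\<in>X. T f \<in> Y \<and> normY (T f) \<le> C * normX f)"

text \<open>\<open>g\<close> is the nonincreasing rearrangement $f^*$ of \<open>f\<close>. As \<open>g\<close> is nonincreasing, its superlevel
  sets are intervals starting at 0, so only their measures have to be prescribed; these determine
  \<open>g\<close> almost everywhere. On $L^p$ the rearrangement is finite at every point of $(0,\infty)$,
  hence real-valued.\<close>

definition nonincr_rearrangement :: "int \<Rightarrow> (real \<Rightarrow> real) \<Rightarrow> (real \<Rightarrow> real) \<Rightarrow> bool" where
  "nonincr_rearrangement m f g \<longleftrightarrow>
     antimono_on {0<..} g \<and> (\<forall>r>0. 0 \<le> g r) \<and>
     (\<forall>t>0. emeasure (radial_measure m) {r \<in> {0<..}. t \<le> g r} =
             emeasure (radial_measure m) {r \<in> {0<..}. t \<le> \<bar>f r\<bar>})"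

definition dilation :: "int \<Rightarrow> real \<Rightarrow> real \<Rightarrow> (real \<Rightarrow> real) \<Rightarrow> real \<Rightarrow> real" where
  "dilation m p c f = (\<lambda>r. c powr (of_int m / p) * f (c * r))"

definition optimal_const ::
  "int \<Rightarrow> real \<Rightarrow> real measure \<Rightarrow> real \<Rightarrow> ((real \<Rightarrow> real) \<Rightarrow> real \<Rightarrow> real) \<Rightarrow> real" where
  "optimal_const m p \<sigma> q T =
     Inf {A. 0 \<le> A \<and> (\<forall>f\<in>Lp_space (radial_measure m) p.
                Lp_norm \<sigma> q (T f) \<le> A * Lp_norm (radial_measure m) p f)}"

definition extremizer ::
  "int \<Rightarrow> real \<Rightarrow> real measure \<Rightarrow> real \<Rightarrow> ((real \<Rightarrow> real) \<Rightarrow> real \<Rightarrow> real) \<Rightarrow> (real \<Rightarrow> real) \<Rightarrow> bool" where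
  "extremizer m p \<sigma> q T f \<longleftrightarrow>
     f \<in> Lp_space (radial_measure m) p \<and> \<not> (AE r in radial_measure m. f r = 0) \<and>
     Lp_norm \<sigma> q (T f) = optimal_const m p \<sigma> q T * Lp_norm (radial_measure m) p f"

definition extremizing_sequence ::
  "int \<Rightarrow> real \<Rightarrow> real measure \<Rightarrow> real \<Rightarrow> ((real \<Rightarrow> real) \<Rightarrow> real \<Rightarrow> real) \<Rightarrow> (nat \<Rightarrow> real \<Rightarrow> real) \<Rightarrow> bool" where
  "extremizing_sequence m p \<sigma> q T F \<longleftrightarrow>
     (\<forall>n. F n \<in> Lp_space (radial_measure m) p \<and> Lp_norm (radial_measure m) p (F n) = 1) \<and>
     (\<lambda>n. Lp_norm \<sigma> q (T (F n))) \<longlonglongrightarrow> optimal_const m p \<sigma> q T"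

definition rel_compact_mod_dilations :: "int \<Rightarrow> real \<Rightarrow> (nat \<Rightarrow> real \<Rightarrow> real) \<Rightarrow> bool" where
  "rel_compact_mod_dilations m p F \<longleftrightarrow>
     (\<exists>c. (\<forall>n. 0 < c n) \<and>
       (\<exists>k g. strict_mono (k :: nat \<Rightarrow> nat) \<and> g \<in> Lp_space (radial_measure m) p \<and>
         (\<lambda>n. Lp_norm (radial_measure m) p (\<lambda>r. dilation m p (c (k n)) (F (k n)) r - g r))
           \<longlonglongrightarrow> 0))"

end

theory Submission
  imports Defs
begin

text \<open>Call the operator \<open>T\<close>, the optimal constant \<open>A\<close>, and suppose \<open>A > 0\<close>. The difficulty is the lack
  of compactness: an extremizing sequence could concentrate, spread out, or split. Monotonicity makes
  each of these tractable.

  First, by the rearrangement inequality there is an extremizing sequence of nonnegative decreasing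
  functions (\<open>extremizing_antimono_sequence_exists\<close>). For a decreasing \<open>f\<close> of unit norm in \<open>L^p\<close>,
  the Lorentz norm with second exponent \<open>p + \<delta>\<close> is bounded by a power of the weak norm, that is, up to
  a constant, of the supremum of \<open>r^(m/p) f(r)\<close>. The improved Lorentz bound on \<open>T\<close> therefore shows that this
  supremum stays away from 0 along an extremizing sequence (\<open>extremizing_not_weakly_small\<close>). A
  dilation then makes the values at 1 at least some fixed \<open>\<kappa> > 0\<close>, so that no pointwise limit is zero.

  Next, decreasing functions bounded in \<open>L^p\<close> are bounded pointwise, so Helly's selection theorem gives
  a pointwise limit \<open>g\<close>. The images are decreasing too, so a further subsequence of the images
  converges almost everywhere. Its limit is the image of \<open>g\<close>, by weak continuity of bounded operators;
  this is proved by an elementary averaging argument (\<open>image_limit_of_null_sequence\<close>).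

  Finally, almost everywhere convergence on both sides allows the Brezis-Lieb lemma to split the
  masses. If \<open>g\<close> carries the part \<open>a\<close> of the mass in \<open>L^p\<close>, then \<open>A^q\<close> is at most
  \<open>A^q (a^(q/p) + (1 - a)^(q/p))\<close>. As \<open>q > p\<close> and \<open>a > 0\<close>, this leaves only \<open>a = 1\<close>; hence the
  dilated sequence converges to \<open>g\<close> in norm and \<open>g\<close> is an extremizer
  (\<open>extremizing_antimono_sequence_compact\<close>).\<close>

section \<open>Powers of sums and the Brezis-Lieb lemma\<close>

text \<open>Convexity of the power function, applied to a and b rescaled by the weights 1 - l and l. The
  coefficient of the first term tends to 1 as l tends to 0, at the price of a large coefficient on
  the second one; this asymmetry is what the Brezis-Lieb lemma needs.\<close>

lemma powr_abs_add_le: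
  fixes a b l p :: real
  assumes "1 < p" "0 < l" "l < 1"
  shows "\<bar>a + b\<bar> powr p \<le> (1 - l) powr (1 - p) * \<bar>a\<bar> powr p + l powr (1 - p) * \<bar>b\<bar> powr p"
proof (cases "a = 0 \<or> b = 0")
  case True
  have "1 \<le> (1 - l) powr (1 - p)" "1 \<le> l powr (1 - p)"
    using assms powr_mono'[of "1 - p" 0 l] powr_mono'[of "1 - p" 0 "1 - l"] by auto
  moreover have "0 \<le> \<bar>a\<bar> powr p" "0 \<le> \<bar>b\<bar> powr p" by auto
  ultimately show ?thesis
    using True mult_right_mono[of 1 "(1 - l) powr (1 - p)" "\<bar>a\<bar> powr p"]
      mult_right_mono[of 1 "l powr (1 - p)" "\<bar>b\<bar> powr p"] by auto
next
  case False
  have cv: "convex_on {0<..} (\<lambda>x::real. x powr p)"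
    using assms powr_convex[of p] by auto
  have "\<bar>a + b\<bar> powr p \<le> (\<bar>a\<bar> + \<bar>b\<bar>) powr p"
    by (intro powr_mono2) (use assms in auto)
  also have "\<bar>a\<bar> + \<bar>b\<bar> = (1 - l) *\<^sub>R (\<bar>a\<bar> / (1 - l)) + l *\<^sub>R (\<bar>b\<bar> / l)"
    using assms by simp
  also have "\<dots> powr p \<le> (1 - l) * (\<bar>a\<bar> / (1 - l)) powr p + l * (\<bar>b\<bar> / l) powr p"
    using convex_onD[OF cv, of l "\<bar>a\<bar> / (1 - l)" "\<bar>b\<bar> / l"] assms False by simp
  also have "\<dots> = (1 - l) powr (1 - p) * \<bar>a\<bar> powr p + l powr (1 - p) * \<bar>b\<bar> powr p"
    using assms by (simp add: powr_divide powr_diff)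
  finally show ?thesis .
qed

lemma Lp_space_lincomb:
  assumes "1 < p" "f \<in> Lp_space M p" "g \<in> Lp_space M p"
  shows "(\<lambda>x. a * f x + b * g x) \<in> Lp_space M p"
proof -
  have [measurable]: "f \<in> borel_measurable M" "g \<in> borel_measurable M"
    using assms by (auto simp: Lp_space_def)
  have int: "integrable M (\<lambda>x. \<bar>f x\<bar> powr p)" "integrable M (\<lambda>x. \<bar>g x\<bar> powr p)"
    using assms by (auto simp: Lp_space_def)
  let ?c = "(1/2) powr (1 - p) :: real"
  have "integrable M (\<lambda>x. \<bar>a * f x + b * g x\<bar> powr p)"
  proof (rule Bochner_Integration.integrable_bound)
    show "integrable M (\<lambda>x. ?c * (\<bar>a\<bar> powr p * \<bar>f x\<bar> powr p) + ?c * (\<bar>b\<bar> powr p * \<bar>g x\<bar> powr p))"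
      using int by auto
    show "AE x in M. norm (\<bar>a * f x + b * g x\<bar> powr p)
        \<le> norm (?c * (\<bar>a\<bar> powr p * \<bar>f x\<bar> powr p) + ?c * (\<bar>b\<bar> powr p * \<bar>g x\<bar> powr p))"
      using powr_abs_add_le[OF assms(1), of "1/2" "a * f _" "b * g _"]
      by (intro AE_I2) (auto simp: abs_mult powr_mult)
  qed simp
  thus ?thesis by (auto simp: Lp_space_def)
qed

text \<open>Perturbing a by b changes the power by little relative to a, up to a multiple of the power
  of b: the previous inequality gives the upper bound, and the same inequality for a = (a + b) - b
  gives the lower one.\<close>

lemma powr_abs_add_diff_le:
  fixes p \<epsilon> :: real
  assumes "1 < p" "0 < \<epsilon>"
  shows "\<exists>C\<ge>0. \<forall>a b. \<bar>\<bar>b + a\<bar> powr p - \<bar>a\<bar> powr p - \<bar>b\<bar> powr p\<bar> \<le> \<epsilon> * \<bar>a\<bar> powr p + C * \<bar>b\<bar> powr p"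
proof -
  have "((\<lambda>l::real. (1 - l) powr (1 - p)) \<longlongrightarrow> (1 - 0) powr (1 - p)) (at_right 0)"
    by (intro tendsto_intros) auto
  moreover have "((\<lambda>l::real. (1 - l) powr (p - 1)) \<longlongrightarrow> (1 - 0) powr (p - 1)) (at_right 0)"
    by (intro tendsto_intros) auto
  ultimately have "eventually (\<lambda>l::real. (1 - l) powr (1 - p) < 1 + \<epsilon>) (at_right 0)"
    "eventually (\<lambda>l::real. (1 - l) powr (p - 1) > 1 - \<epsilon>) (at_right 0)"
    using assms by (auto intro: order_tendstoD)
  moreover have "eventually (\<lambda>l::real. 0 < l \<and> l < 1) (at_right 0)"
    using eventually_at_right_real[of 0 1] by simp
  ultimately have "eventually (\<lambda>l::real. (0 < l \<and> l < 1) \<and> (1 - l) powr (1 - p) < 1 + \<epsilon>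
      \<and> (1 - l) powr (p - 1) > 1 - \<epsilon>) (at_right 0)"
    by (intro eventually_conj[OF _ eventually_conj])
  then obtain l where l: "0 < l" "l < 1" "(1 - l) powr (1 - p) < 1 + \<epsilon>" "(1 - l) powr (p - 1) > 1 - \<epsilon>"
    using eventually_happens'[of "at_right (0::real)"] by auto
  define C where "C = l powr (1 - p)"
  have C0: "C \<ge> 0" by (simp add: C_def)
  have "\<bar>\<bar>b + a\<bar> powr p - \<bar>a\<bar> powr p - \<bar>b\<bar> powr p\<bar> \<le> \<epsilon> * \<bar>a\<bar> powr p + (C + 1) * \<bar>b\<bar> powr p" for a b
  proof -
    have "\<bar>b + a\<bar> powr p \<le> (1 - l) powr (1 - p) * \<bar>a\<bar> powr p + C * \<bar>b\<bar> powr p"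
      using powr_abs_add_le[OF assms(1) l(1,2), of a b] by (simp add: C_def add.commute)
    also have "\<dots> \<le> (1 + \<epsilon>) * \<bar>a\<bar> powr p + C * \<bar>b\<bar> powr p"
      using l by (intro add_mono mult_right_mono) auto
    finally have up: "\<bar>b + a\<bar> powr p \<le> (1 + \<epsilon>) * \<bar>a\<bar> powr p + C * \<bar>b\<bar> powr p" .
    have "\<bar>a\<bar> powr p \<le> (1 - l) powr (1 - p) * \<bar>b + a\<bar> powr p + C * \<bar>b\<bar> powr p"
      using powr_abs_add_le[OF assms(1) l(1,2), of "b + a" "- b"] by (simp add: C_def)
    hence "(1 - l) powr (p - 1) * \<bar>a\<bar> powr p
        \<le> (1 - l) powr (p - 1) * ((1 - l) powr (1 - p) * \<bar>b + a\<bar> powr p + C * \<bar>b\<bar> powr p)"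
      by (intro mult_left_mono) auto
    also have "\<dots> = \<bar>b + a\<bar> powr p + (1 - l) powr (p - 1) * (C * \<bar>b\<bar> powr p)"
      using l by (simp add: distrib_left mult.assoc[symmetric] powr_add[symmetric])
    also have "\<dots> \<le> \<bar>b + a\<bar> powr p + 1 * (C * \<bar>b\<bar> powr p)"
      using l C0 assms(1) by (intro add_left_mono mult_right_mono) (auto intro!: powr_le1)
    finally have "(1 - l) powr (p - 1) * \<bar>a\<bar> powr p \<le> \<bar>b + a\<bar> powr p + C * \<bar>b\<bar> powr p" by simp
    moreover have "(1 - \<epsilon>) * \<bar>a\<bar> powr p \<le> (1 - l) powr (p - 1) * \<bar>a\<bar> powr p"
      using l by (intro mult_right_mono) auto
    ultimately have "(1 - \<epsilon>) * \<bar>a\<bar> powr p \<le> \<bar>b + a\<bar> powr p + C * \<bar>b\<bar> powr p" by linarith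
    moreover have "0 \<le> \<bar>b\<bar> powr p" "0 \<le> C * \<bar>b\<bar> powr p" using C0 by auto
    ultimately show ?thesis using up unfolding abs_le_iff ring_distribs by linarith
  qed
  thus ?thesis using C0 by (intro exI[of _ "C+1"]) auto
qed

text \<open>The Brezis-Lieb lemma: a bounded sequence tending to 0 almost everywhere asymptotically shares
  no mass with a fixed function, so the p-th powers of the norms add up. It replaces weak convergence
  throughout: it splits the mass of an extremizing sequence in the domain and in the target, and it
  also shows that such sequences can be averaged down to zero.\<close>

lemma brezis_lieb:
  fixes f :: "real \<Rightarrow> real" and u :: "nat \<Rightarrow> real \<Rightarrow> real"
  assumes p: "1 < p" and f: "f \<in> Lp_space M p" and u: "\<And>n. u n \<in> Lp_space M p"
    and ae: "AE x in M. (\<lambda>n. u n x) \<longlonglongrightarrow> 0"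
    and bd: "\<And>n. (\<integral>x. \<bar>u n x\<bar> powr p \<partial>M) \<le> B"
  shows "(\<lambda>n. (\<integral>x. \<bar>f x + u n x\<bar> powr p \<partial>M) - (\<integral>x. \<bar>u n x\<bar> powr p \<partial>M))
           \<longlonglongrightarrow> (\<integral>x. \<bar>f x\<bar> powr p \<partial>M)"
proof -
  have [measurable]: "f \<in> borel_measurable M" "u n \<in> borel_measurable M" for n
    using f u[of n] by (auto simp: Lp_space_def)
  have fi: "integrable M (\<lambda>x. \<bar>f x\<bar> powr p)" and ui: "integrable M (\<lambda>x. \<bar>u n x\<bar> powr p)" for n
    using f u[of n] by (auto simp: Lp_space_def)
  have si: "integrable M (\<lambda>x. \<bar>f x + u n x\<bar> powr p)" for n
    using Lp_space_lincomb[OF p f u[of n], of 1 1] by (simp add: Lp_space_def)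
  define D where "D n x = \<bar>f x + u n x\<bar> powr p - \<bar>u n x\<bar> powr p - \<bar>f x\<bar> powr p" for n x
  have Di: "integrable M (D n)" for n unfolding D_def using fi ui si by auto
  have Deq: "(\<integral>x. D n x \<partial>M) = (\<integral>x. \<bar>f x + u n x\<bar> powr p \<partial>M) - (\<integral>x. \<bar>u n x\<bar> powr p \<partial>M) - (\<integral>x. \<bar>f x\<bar> powr p \<partial>M)" for n
    unfolding D_def using fi ui si by simp
  have B0: "B \<ge> 0" using bd[of 0] by (rule order_trans[rotated]) simp
  have "(\<lambda>n. \<integral>x. D n x \<partial>M) \<longlonglongrightarrow> 0"
  proof (rule LIMSEQ_I)
    fix e :: real assume e: "0 < e"
    define \<epsilon> where "\<epsilon> = e / (2 * (B + 1))"
    have \<epsilon>: "0 < \<epsilon>" using e B0 by (auto simp: \<epsilon>_def field_simps)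
    have \<epsilon>B: "\<epsilon> * B \<le> e / 2" using e B0 by (auto simp: \<epsilon>_def field_simps)
    obtain C where C: "C \<ge> 0" "\<And>a b. \<bar>\<bar>b + a\<bar> powr p - \<bar>a\<bar> powr p - \<bar>b\<bar> powr p\<bar> \<le> \<epsilon> * \<bar>a\<bar> powr p + C * \<bar>b\<bar> powr p"
      using powr_abs_add_diff_le[OF p \<epsilon>] by blast
    \<comment> \<open>The excess of D n over a small multiple of the power of u n is dominated by an integrable
      function; what is cut off has integral at most e/2, uniformly in n.\<close>
    define W where "W n x = max 0 (\<bar>D n x\<bar> - \<epsilon> * \<bar>u n x\<bar> powr p)" for n x
    have [measurable]: "W n \<in> borel_measurable M" for n unfolding W_def D_def by measurable
    have Wle: "norm (W n x) \<le> C * \<bar>f x\<bar> powr p" for n x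
      using C(2)[of "f x" "u n x"] C(1) unfolding W_def D_def by auto
    have "(\<lambda>n. \<integral>x. W n x \<partial>M) \<longlonglongrightarrow> (\<integral>x. 0 \<partial>M)"
    proof (rule integral_dominated_convergence)
      show "integrable M (\<lambda>x. C * \<bar>f x\<bar> powr p)" using fi by auto
      show "AE x in M. (\<lambda>n. W n x) \<longlonglongrightarrow> 0" using ae
      proof eventually_elim
        case (elim x)
        have "(\<lambda>n. max 0 (\<bar>\<bar>f x + u n x\<bar> powr p - \<bar>u n x\<bar> powr p - \<bar>f x\<bar> powr p\<bar> - \<epsilon> * \<bar>u n x\<bar> powr p))
           \<longlonglongrightarrow> max 0 (\<bar>\<bar>f x + 0\<bar> powr p - \<bar>0\<bar> powr p - \<bar>f x\<bar> powr p\<bar> - \<epsilon> * \<bar>0\<bar> powr p)"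
          using p by (intro tendsto_intros tendsto_powr2 elim) auto
        thus ?case by (simp add: W_def D_def)
      qed
    qed (use Wle in auto)
    hence evW: "eventually (\<lambda>n. (\<integral>x. W n x \<partial>M) < e / 2) sequentially"
      using e by (intro order_tendstoD) auto
    have Wi: "integrable M (W n)" for n
      by (rule Bochner_Integration.integrable_bound[of _ "\<lambda>x. C * \<bar>f x\<bar> powr p"]) (use fi Wle C in \<open>auto simp: abs_mult\<close>)
    have Dle: "\<bar>\<integral>x. D n x \<partial>M\<bar> \<le> (\<integral>x. W n x \<partial>M) + e / 2" for n
    proof -
      have "\<bar>\<integral>x. D n x \<partial>M\<bar> \<le> (\<integral>x. \<bar>D n x\<bar> \<partial>M)" by (rule integral_abs_bound)
      also have "\<dots> \<le> (\<integral>x. W n x + \<epsilon> * \<bar>u n x\<bar> powr p \<partial>M)"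
        using Di Wi ui by (intro integral_mono) (auto simp: W_def)
      also have "\<dots> = (\<integral>x. W n x \<partial>M) + \<epsilon> * (\<integral>x. \<bar>u n x\<bar> powr p \<partial>M)" using Wi ui by simp
      also have "\<dots> \<le> (\<integral>x. W n x \<partial>M) + \<epsilon> * B" using \<epsilon> bd by (intro add_left_mono mult_left_mono) auto
      finally show ?thesis using \<epsilon>B by linarith
    qed
    from evW have "eventually (\<lambda>n. \<bar>\<integral>x. D n x \<partial>M\<bar> < e) sequentially"
    proof eventually_elim
      case (elim n)
      thus ?case using Dle[of n] by linarith
    qed
    thus "\<exists>N. \<forall>n\<ge>N. norm ((\<integral>x. D n x \<partial>M) - 0) < e" by (simp add: eventually_sequentially)
  qed
  hence "(\<lambda>n. (\<integral>x. D n x \<partial>M) + (\<integral>x. \<bar>f x\<bar> powr p \<partial>M)) \<longlonglongrightarrow> 0 + (\<integral>x. \<bar>f x\<bar> powr p \<partial>M)"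
    by (intro tendsto_intros)
  thus ?thesis by (simp add: Deq)
qed

section \<open>Helly selection for decreasing functions\<close>

text \<open>Diagonal extraction, in the form of sequential compactness of a countable product of
  intervals, which is metrizable.\<close>

lemma countable_convergent_subsequence:
  fixes \<phi> :: "nat \<Rightarrow> 'a \<Rightarrow> real"
  assumes "countable S" "\<And>n x. x \<in> S \<Longrightarrow> \<bar>\<phi> n x\<bar> \<le> B x"
  obtains k :: "nat \<Rightarrow> nat" where "strict_mono k" "\<And>x. x \<in> S \<Longrightarrow> convergent (\<lambda>n. \<phi> (k n) x)"
proof (cases "S = {}")
  case True
  thus ?thesis using that[of id] by (auto simp: strict_mono_def)
next
  case False
  define s where "s = from_nat_into S"
  have s: "s i \<in> S" for i using False by (simp add: s_def from_nat_into)
  have surj: "\<exists>i. s i = x" if "x \<in> S" for x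
    using from_nat_into_to_nat_on[OF assms(1) that] by (auto simp: s_def)
  let ?K = "PiE UNIV (\<lambda>i. {- B (s i)..B (s i)})"
  have "compactin (product_topology (\<lambda>_. euclideanreal) (UNIV :: nat set)) ?K"
    by (subst compactin_PiE) auto
  hence "compact ?K" by (simp add: euclidean_product_topology)
  hence "seq_compact ?K" by (simp add: compact_eq_seq_compact_metric)
  moreover have "\<forall>n. (\<lambda>i. \<phi> n (s i)) \<in> ?K"
    using abs_le_D1[OF assms(2)[OF s]] abs_le_D2[OF assms(2)[OF s]]
    by (auto simp: minus_le_iff[of "\<phi> _ _"])
  ultimately obtain l k where k: "strict_mono k" "((\<lambda>n i. \<phi> n (s i)) \<circ> k) \<longlonglongrightarrow> l"
    by (auto elim!: seq_compactE)
  have "(\<lambda>n. \<phi> (k n) (s i)) \<longlonglongrightarrow> l i" for i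
    using continuous_on_tendsto_compose[OF continuous_on_product_coordinates[of i] k(2)]
    by (simp add: o_def)
  hence "convergent (\<lambda>n. \<phi> (k n) x)" if "x \<in> S" for x
    using surj[OF that] by (auto simp: convergent_def)
  thus ?thesis using that k(1) by blast
qed

text \<open>Helly's selection theorem with convergence at every point. A first subsequence converges at the
  rational points. For it, monotonicity makes the intervals from the lower to the upper limit at
  different points disjoint, so that only countably many points are bad, and a second extraction
  deals with those. Exceptional countable sets are not tolerable here, since the measure on the
  target side may have atoms.\<close>

lemma helly_selection_antimono:
  fixes \<phi> :: "nat \<Rightarrow> real \<Rightarrow> real"
  assumes E: "is_interval E" and mono: "\<And>n. antimono_on E (\<phi> n)"
    and bd: "\<And>n x. x \<in> E \<Longrightarrow> \<bar>\<phi> n x\<bar> \<le> B x"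
  obtains k :: "nat \<Rightarrow> nat" where "strict_mono k" "\<And>x. x \<in> E \<Longrightarrow> convergent (\<lambda>n. \<phi> (k n) x)"
proof -
  obtain k1 :: "nat \<Rightarrow> nat" where k1: "strict_mono k1"
    "\<And>x. x \<in> E \<inter> \<rat> \<Longrightarrow> convergent (\<lambda>n. \<phi> (k1 n) x)"
  proof (rule countable_convergent_subsequence[of "E \<inter> \<rat>" \<phi> B])
    show "countable (E \<inter> \<rat>)" using countable_rat by (rule countable_Int2)
  qed (use bd in auto)
  define X where "X x n = ereal (\<phi> (k1 n) x)" for x n
  define Z where "Z = {x\<in>E. \<not> convergent (\<lambda>n. \<phi> (k1 n) x)}"
  have lt: "liminf (X x) < limsup (X x)" if "x \<in> Z" for x
  proof (rule ccontr)
    assume "\<not> ?thesis"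
    hence eq: "limsup (X x) = liminf (X x)" using Liminf_le_Limsup[of sequentially "X x"] by simp
    hence "convergent (X x)" by (simp add: convergent_ereal)
    then obtain L where L: "X x \<longlonglongrightarrow> L" by (auto simp: convergent_def)
    have "x \<in> E" using that by (simp add: Z_def)
    hence "\<bar>L\<bar> \<le> ereal (B x)" using bd
      by (intro tendsto_upperbound[OF tendsto_abs_ereal[OF L]]) (auto simp: X_def)
    then obtain l where "L = ereal l" by (cases L) auto
    hence "(\<lambda>n. \<phi> (k1 n) x) \<longlonglongrightarrow> l" using L by (simp add: X_def[abs_def])
    thus False using that by (auto simp: Z_def convergent_def)
  qed
  have ord: "limsup (X y) \<le> liminf (X x)" if xy: "x \<in> E" "y \<in> E" "x < y" for x y
  proof -
    obtain r where r: "r \<in> \<rat>" "x < r" "r < y" using Rats_dense_in_real[OF xy(3)] by blast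
    have rE: "r \<in> E" using E xy r unfolding is_interval_1 by (meson less_imp_le)
    then obtain l where l: "(\<lambda>n. \<phi> (k1 n) r) \<longlonglongrightarrow> l" using k1(2) r by (auto simp: convergent_def)
    have "X r \<longlonglongrightarrow> ereal l" using l by (simp add: X_def[abs_def])
    hence "limsup (X r) = liminf (X r)" by (simp add: lim_imp_Limsup lim_imp_Liminf)
    moreover have "limsup (X y) \<le> limsup (X r)"
      using mono rE xy r by (intro Limsup_mono) (auto simp: X_def monotone_on_def)
    moreover have "liminf (X r) \<le> liminf (X x)"
      using mono rE xy r by (intro Liminf_mono) (auto simp: X_def monotone_on_def)
    ultimately show ?thesis by simp
  qed
  \<comment> \<open>The gaps at the points of Z are disjoint, so choosing a rational in each one is injective.\<close>
  have "\<forall>x\<in>Z. \<exists>r::rat. liminf (X x) < ereal (of_rat r) \<and> ereal (of_rat r) < limsup (X x)"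
  proof
    fix x assume "x \<in> Z"
    from ereal_dense2[OF lt[OF this]] obtain c where c: "liminf (X x) < ereal c" "ereal c < limsup (X x)" by blast
    from ereal_dense2[OF c(2)] obtain d where d: "ereal c < ereal d" "ereal d < limsup (X x)" by blast
    from of_rat_dense[of c d] d obtain r where r: "c < of_rat r" "of_rat r < d" by auto
    have "liminf (X x) < ereal (of_rat r)" using r(1) by (intro less_trans[OF c(1)]) simp
    moreover have "ereal (of_rat r) < limsup (X x)" using r(2) by (intro less_trans[OF _ d(2)]) simp
    ultimately show "\<exists>r::rat. liminf (X x) < ereal (of_rat r) \<and> ereal (of_rat r) < limsup (X x)"
      by blast
  qed
  then obtain \<rho> :: "real \<Rightarrow> rat" where \<rho>: "\<And>x. x \<in> Z \<Longrightarrow> liminf (X x) < ereal (of_rat (\<rho> x))"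
    "\<And>x. x \<in> Z \<Longrightarrow> ereal (of_rat (\<rho> x)) < limsup (X x)" by metis
  have "\<rho> x \<noteq> \<rho> y" if "x \<in> Z" "y \<in> Z" "x < y" for x y
    using ord[of x y] that \<rho>(1)[of x] \<rho>(2)[of y] by (auto simp: Z_def)
  hence "inj_on \<rho> Z" by (intro linorder_inj_onI') auto
  hence "countable Z" using countableI' by blast
  then obtain k2 :: "nat \<Rightarrow> nat" where k2: "strict_mono k2"
    "\<And>x. x \<in> Z \<Longrightarrow> convergent (\<lambda>n. \<phi> (k1 (k2 n)) x)"
  proof (rule countable_convergent_subsequence[of Z "\<lambda>n. \<phi> (k1 n)" B])
  qed (use bd \<open>countable Z\<close> in \<open>auto simp: Z_def\<close>)
  have "convergent (\<lambda>n. \<phi> ((k1 \<circ> k2) n) x)" if "x \<in> E" for x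
  proof (cases "x \<in> Z")
    case False
    hence "convergent (\<lambda>n. \<phi> (k1 n) x)" using that by (simp add: Z_def)
    from convergent_subseq_convergent[OF this k2(1)] show ?thesis by (simp add: o_def)
  qed (use k2 in auto)
  moreover have "strict_mono (k1 \<circ> k2)" using k1 k2 by (simp add: strict_mono_o)
  ultimately show ?thesis using that by blast
qed

section \<open>Images of bounded null sequences\<close>

lemma Lp_norm_powr: "0 < p \<Longrightarrow> Lp_norm M p f powr p = (\<integral>x. \<bar>f x\<bar> powr p \<partial>M)"
  by (simp add: Lp_norm_def powr_powr)

lemma Lp_norm_le_imp_integral_le:
  assumes "0 < p" "0 < q" "0 \<le> C" "Lp_norm N q g \<le> C * Lp_norm M p f"
  shows "(\<integral>x. \<bar>g x\<bar> powr q \<partial>N) \<le> C powr q * (\<integral>x. \<bar>f x\<bar> powr p \<partial>M) powr (q / p)"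
proof -
  have "(\<integral>x. \<bar>g x\<bar> powr q \<partial>N) = Lp_norm N q g powr q" using assms by (simp add: Lp_norm_powr)
  also have "\<dots> \<le> (C * Lp_norm M p f) powr q"
    using assms by (intro powr_mono2) (auto simp: Lp_norm_def)
  also have "\<dots> = C powr q * (\<integral>x. \<bar>f x\<bar> powr p \<partial>M) powr (q / p)"
    using assms by (simp add: powr_mult powr_powr Lp_norm_def)
  finally show ?thesis .
qed

text \<open>Averaging each term of a null sequence with a much later one: the two nearly decouple by the
  Brezis-Lieb lemma, so the p-th power of the norm of the average is about 2 (1/2)^p = 2^(1-p) times
  the original bound, while the limit of the images is unchanged by linearity.\<close>

lemma averaged_null_sequence:
  assumes p: "1 < p"
    and lin: "\<And>f g a b. f \<in> Lp_space M p \<Longrightarrow> g \<in> Lp_space M p \<Longrightarrow>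
      AE x in N. T (\<lambda>r. a * f r + b * g r) x = a * T f x + b * T g x"
    and u: "\<And>n. u n \<in> Lp_space M p"
    and ae: "AE x in M. (\<lambda>n. u n x) \<longlonglongrightarrow> 0"
    and bd: "\<And>n. (\<integral>x. \<bar>u n x\<bar> powr p \<partial>M) \<le> B" and B: "0 < B"
    and w: "AE x in N. (\<lambda>n. T (u n) x) \<longlonglongrightarrow> w x"
    and \<theta>: "2 powr (1 - p) < \<theta>"
  obtains v where "\<And>n. v n \<in> Lp_space M p" "AE x in M. (\<lambda>n. v n x) \<longlonglongrightarrow> 0"
    "\<And>n. (\<integral>x. \<bar>v n x\<bar> powr p \<partial>M) \<le> \<theta> * B" "AE x in N. (\<lambda>n. T (v n) x) \<longlonglongrightarrow> w x"
proof -
  have "\<exists>k\<ge>n. (\<integral>x. \<bar>u n x + u k x\<bar> powr p \<partial>M) \<le> 2 powr p * \<theta> * B" for n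
  proof -
    \<comment> \<open>Strict because \<open>\<theta>\<close> exceeds \<open>2 powr (1 - p)\<close>; the slack absorbs the error in the decoupling.\<close>
    have "(\<integral>x. \<bar>u n x\<bar> powr p \<partial>M) < 2 powr p * \<theta> * B - B"
    proof -
      have "2 = 2 powr p * 2 powr (1 - p)" by (simp add: powr_add[symmetric])
      also have "\<dots> < 2 powr p * \<theta>" using \<theta> by simp
      finally have "2 * B < 2 powr p * \<theta> * B" using B by simp
      thus ?thesis using bd[of n] by linarith
    qed
    with brezis_lieb[OF p u[of n] u ae bd]
    have "eventually (\<lambda>k. (\<integral>x. \<bar>u n x + u k x\<bar> powr p \<partial>M) - (\<integral>x. \<bar>u k x\<bar> powr p \<partial>M) < 2 powr p * \<theta> * B - B) sequentially"
      by (rule order_tendstoD)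
    then obtain N where "\<And>k. k \<ge> N \<Longrightarrow> (\<integral>x. \<bar>u n x + u k x\<bar> powr p \<partial>M) - (\<integral>x. \<bar>u k x\<bar> powr p \<partial>M) < 2 powr p * \<theta> * B - B"
      by (auto simp: eventually_sequentially)
    from this[of "max n N"] bd[of "max n N"] show ?thesis by (intro exI[of _ "max n N"]) auto
  qed
  then obtain k where k: "\<And>n. k n \<ge> n" "\<And>n. (\<integral>x. \<bar>u n x + u (k n) x\<bar> powr p \<partial>M) \<le> 2 powr p * \<theta> * B" by metis
  have kinf: "filterlim k at_top sequentially"
    using k(1) by (intro filterlim_at_top_mono[OF filterlim_ident]) auto
  define v where "v n = (\<lambda>x. 1/2 * u n x + 1/2 * u (k n) x)" for n
  have "v n \<in> Lp_space M p" for n unfolding v_def by (rule Lp_space_lincomb[OF p u u])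
  moreover have "AE x in M. (\<lambda>n. v n x) \<longlonglongrightarrow> 0" using ae
  proof eventually_elim
    case (elim x)
    have "(\<lambda>n. v n x) \<longlonglongrightarrow> 1/2 * 0 + 1/2 * 0" unfolding v_def
      by (intro tendsto_add tendsto_mult tendsto_const elim filterlim_compose[OF elim kinf])
    thus ?case by simp
  qed
  moreover have "(\<integral>x. \<bar>v n x\<bar> powr p \<partial>M) \<le> \<theta> * B" for n
  proof -
    have "\<bar>v n x\<bar> powr p = (1/2) powr p * \<bar>u n x + u (k n) x\<bar> powr p" for x
    proof -
      have "v n x = 1/2 * (u n x + u (k n) x)" by (simp add: v_def)
      thus ?thesis by (simp only: abs_mult powr_mult)
    qed
    hence "(\<integral>x. \<bar>v n x\<bar> powr p \<partial>M) = (1/2) powr p * (\<integral>x. \<bar>u n x + u (k n) x\<bar> powr p \<partial>M)" by simp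
    also have "\<dots> \<le> (1/2) powr p * (2 powr p * \<theta> * B)" by (intro mult_left_mono k) auto
    also have "\<dots> = \<theta> * B" by (simp add: powr_divide)
    finally show ?thesis .
  qed
  moreover have "AE x in N. (\<lambda>n. T (v n) x) \<longlonglongrightarrow> w x"
  proof -
    have "AE x in N. \<forall>n. T (v n) x = 1/2 * T (u n) x + 1/2 * T (u (k n)) x"
      unfolding v_def AE_all_countable by (intro allI lin u)
    with w show ?thesis
    proof eventually_elim
      case (elim x)
      have "(\<lambda>n. 1/2 * T (u n) x + 1/2 * T (u (k n)) x) \<longlonglongrightarrow> 1/2 * w x + 1/2 * w x"
        by (intro tendsto_intros elim filterlim_compose[OF elim(1) kinf])
      thus ?case using elim by simp
    qed
  qed
  ultimately show ?thesis using that by blast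
qed

text \<open>A bounded linear operator is weakly continuous, so the almost everywhere limit w of the
  images of a bounded null sequence must vanish. Weak topologies are avoided by iterating the previous
  lemma: w is also the limit of images of sequences of arbitrarily small norm, hence zero by Fatou.
  This needs p > 1.\<close>

lemma image_limit_of_null_sequence:
  assumes p: "1 < p" and q: "0 < q"
    and T: "bounded_linear_op (Lp_space M p) (Lp_norm M p) (Lp_space N q) (Lp_norm N q) N T"
    and u: "\<And>n. u n \<in> Lp_space M p"
    and ae: "AE x in M. (\<lambda>n. u n x) \<longlonglongrightarrow> 0"
    and bd: "\<And>n. (\<integral>x. \<bar>u n x\<bar> powr p \<partial>M) \<le> B"
    and w_meas[measurable]: "w \<in> borel_measurable N"
    and w: "AE x in N. (\<lambda>n. T (u n) x) \<longlonglongrightarrow> w x"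
  shows "AE x in N. w x = 0"
proof -
  have lin: "AE x in N. T (\<lambda>r. a * f r + b * g r) x = a * T f x + b * T g x"
    if "f \<in> Lp_space M p" "g \<in> Lp_space M p" for f g a b
    using T that unfolding bounded_linear_op_def by blast
  obtain C0 where C0: "\<And>f. f \<in> Lp_space M p \<Longrightarrow> T f \<in> Lp_space N q \<and> Lp_norm N q (T f) \<le> C0 * Lp_norm M p f"
    using T unfolding bounded_linear_op_def by blast
  define C where "C = max C0 0"
  have C: "C \<ge> 0" "Lp_norm N q (T f) \<le> C * Lp_norm M p f" if "f \<in> Lp_space M p" for f
  proof -
    have "C0 * Lp_norm M p f \<le> C * Lp_norm M p f"
      by (intro mult_right_mono) (auto simp: C_def Lp_norm_def)
    thus "Lp_norm N q (T f) \<le> C * Lp_norm M p f" using C0[OF that] by linarith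
  qed (simp add: C_def)
  define B' where "B' = max B 1"
  have B': "B' > 0" "(\<integral>x. \<bar>u n x\<bar> powr p \<partial>M) \<le> B'" for n using bd[of n] by (auto simp: B'_def)
  have "2 powr (1 - p) < 2 powr (0::real)" using p by (intro powr_less_mono) auto
  then obtain \<theta> :: real where \<theta>: "2 powr (1 - p) < \<theta>" "\<theta> < 1" using dense by auto
  have \<theta>0: "0 < \<theta>" using \<theta>(1) by (rule le_less_trans[rotated]) simp
  have "\<exists>v. (\<forall>n. v n \<in> Lp_space M p) \<and> (AE x in M. (\<lambda>n. v n x) \<longlonglongrightarrow> 0) \<and>
      (\<forall>n. (\<integral>x. \<bar>v n x\<bar> powr p \<partial>M) \<le> \<theta> ^ j * B') \<and> (AE x in N. (\<lambda>n. T (v n) x) \<longlonglongrightarrow> w x)" for j :: nat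
  proof (induction j)
    case 0
    show ?case using u ae B' w by (intro exI[of _ u]) auto
  next
    case (Suc j)
    then obtain v where v: "\<And>n. v n \<in> Lp_space M p" "AE x in M. (\<lambda>n. v n x) \<longlonglongrightarrow> 0"
      "\<And>n. (\<integral>x. \<bar>v n x\<bar> powr p \<partial>M) \<le> \<theta> ^ j * B'" "AE x in N. (\<lambda>n. T (v n) x) \<longlonglongrightarrow> w x" by blast
    have "0 < \<theta> ^ j * B'" using \<theta>0 B' by simp
    from averaged_null_sequence[OF p lin v(1,2,3) this v(4) \<theta>(1)] obtain v' where
      "\<And>n. v' n \<in> Lp_space M p" "AE x in M. (\<lambda>n. v' n x) \<longlonglongrightarrow> 0"
      "\<And>n. (\<integral>x. \<bar>v' n x\<bar> powr p \<partial>M) \<le> \<theta> * (\<theta> ^ j * B')" "AE x in N. (\<lambda>n. T (v' n) x) \<longlonglongrightarrow> w x" by blast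
    thus ?case by (intro exI[of _ v']) (auto simp: mult.assoc)
  qed
  note small = this
  have "(\<integral>\<^sup>+x. ennreal (\<bar>w x\<bar> powr q) \<partial>N) \<le> ennreal (C powr q * (\<theta> ^ j * B') powr (q / p))" for j
  proof -
    obtain v where v: "\<And>n. v n \<in> Lp_space M p"
      "\<And>n. (\<integral>x. \<bar>v n x\<bar> powr p \<partial>M) \<le> \<theta> ^ j * B'" "AE x in N. (\<lambda>n. T (v n) x) \<longlonglongrightarrow> w x"
      using small[of j] by blast
    have Tv: "T (v n) \<in> Lp_space N q" for n using C0[OF v(1)] by simp
    have [measurable]: "T (v n) \<in> borel_measurable N" for n using Tv[of n] by (auto simp: Lp_space_def)
    have "(\<integral>\<^sup>+x. ennreal (\<bar>w x\<bar> powr q) \<partial>N) = (\<integral>\<^sup>+x. liminf (\<lambda>n. ennreal (\<bar>T (v n) x\<bar> powr q)) \<partial>N)"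
    proof (rule nn_integral_cong_AE)
      show "AE x in N. ennreal (\<bar>w x\<bar> powr q) = liminf (\<lambda>n. ennreal (\<bar>T (v n) x\<bar> powr q))" using v(3)
      proof eventually_elim
        case (elim x)
        have "(\<lambda>n. ennreal (\<bar>T (v n) x\<bar> powr q)) \<longlonglongrightarrow> ennreal (\<bar>w x\<bar> powr q)"
          using q by (intro tendsto_ennrealI tendsto_powr2 tendsto_rabs elim) auto
        from lim_imp_Liminf[OF _ this] show ?case by simp
      qed
    qed
    also have "\<dots> \<le> liminf (\<lambda>n. \<integral>\<^sup>+x. ennreal (\<bar>T (v n) x\<bar> powr q) \<partial>N)" by (rule nn_integral_liminf) measurable
    also have "\<dots> \<le> limsup (\<lambda>n. \<integral>\<^sup>+x. ennreal (\<bar>T (v n) x\<bar> powr q) \<partial>N)" by (rule Liminf_le_Limsup) simp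
    also have "\<dots> \<le> ennreal (C powr q * (\<theta> ^ j * B') powr (q / p))"
    proof (intro Limsup_bounded always_eventually allI)
      fix n
      have "(\<integral>\<^sup>+x. ennreal (\<bar>T (v n) x\<bar> powr q) \<partial>N) = ennreal (\<integral>x. \<bar>T (v n) x\<bar> powr q \<partial>N)"
        using Tv[of n] by (intro nn_integral_eq_integral) (auto simp: Lp_space_def)
      also have "(\<integral>x. \<bar>T (v n) x\<bar> powr q \<partial>N) \<le> C powr q * (\<integral>x. \<bar>v n x\<bar> powr p \<partial>M) powr (q / p)"
        using p q C[OF v(1)] by (intro Lp_norm_le_imp_integral_le) auto
      also have "\<dots> \<le> C powr q * (\<theta> ^ j * B') powr (q / p)"
        using v(2) p q by (intro mult_left_mono powr_mono2) auto
      finally show "(\<integral>\<^sup>+x. ennreal (\<bar>T (v n) x\<bar> powr q) \<partial>N) \<le> ennreal (C powr q * (\<theta> ^ j * B') powr (q / p))"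
        by (simp add: ennreal_leI)
    qed
    finally show ?thesis .
  qed
  moreover have "(\<lambda>j. ennreal (C powr q * (\<theta> ^ j * B') powr (q / p))) \<longlonglongrightarrow> ennreal (C powr q * (0 * B') powr (q / p))"
    using \<theta>0 \<theta> p q B'
    by (intro tendsto_ennrealI tendsto_intros tendsto_powr2 LIMSEQ_power_zero) (auto intro!: always_eventually)
  ultimately have "(\<integral>\<^sup>+x. ennreal (\<bar>w x\<bar> powr q) \<partial>N) \<le> ennreal (C powr q * (0 * B') powr (q / p))"
    by (intro LIMSEQ_le_const) auto
  hence "(\<integral>\<^sup>+x. ennreal (\<bar>w x\<bar> powr q) \<partial>N) = 0" by simp
  hence "AE x in N. ennreal (\<bar>w x\<bar> powr q) = 0" by (subst (asm) nn_integral_0_iff_AE) auto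
  thus ?thesis by eventually_elim (auto simp: ennreal_eq_0_iff)
qed

section \<open>Distribution functions\<close>

lemma Lp_space_iff_nn_integral:
  "f \<in> Lp_space M p \<longleftrightarrow> f \<in> borel_measurable M \<and> (\<integral>\<^sup>+x. ennreal (\<bar>f x\<bar> powr p) \<partial>M) < \<infinity>"
  by (auto simp: Lp_space_def integrable_iff_bounded)

lemma Lp_norm_eq_nn_integral:
  "f \<in> borel_measurable M \<Longrightarrow> Lp_norm M p f = enn2real (\<integral>\<^sup>+x. ennreal (\<bar>f x\<bar> powr p) \<partial>M) powr (1 / p)"
  unfolding Lp_norm_def by (subst integral_eq_nn_integral) auto

lemma nn_integral_eq_integral_Lp:
  "f \<in> Lp_space M p \<Longrightarrow> (\<integral>\<^sup>+x. ennreal (\<bar>f x\<bar> powr p) \<partial>M) = ennreal (\<integral>x. \<bar>f x\<bar> powr p \<partial>M)"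
  by (intro nn_integral_eq_integral) (auto simp: Lp_space_def)

lemma superlevel_set_measurable:
  fixes f :: "real \<Rightarrow> real"
  assumes [measurable]: "f \<in> borel_measurable M"
  shows "{x \<in> space M. t \<le> \<bar>f x\<bar>} \<in> sets M"
  by measurable

text \<open>Chebyshev's inequality.\<close>

lemma distr_fun_le_Lp:
  assumes p: "0 < p" and f: "f \<in> Lp_space M p" and t: "0 < t"
  shows "ennreal (t powr p) * distr_fun M f t \<le> ennreal (\<integral>x. \<bar>f x\<bar> powr p \<partial>M)"
proof -
  have [measurable]: "f \<in> borel_measurable M" using f by (simp add: Lp_space_def)
  have "ennreal (t powr p) * distr_fun M f t = (\<integral>\<^sup>+x. ennreal (t powr p) * indicator {x \<in> space M. t \<le> \<bar>f x\<bar>} x \<partial>M)"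
    unfolding distr_fun_def by (intro nn_integral_cmult_indicator[symmetric]) measurable
  also have "\<dots> \<le> (\<integral>\<^sup>+x. ennreal (\<bar>f x\<bar> powr p) \<partial>M)"
    using p t by (intro nn_integral_mono) (auto simp: indicator_def intro!: ennreal_leI powr_mono2)
  finally show ?thesis by (simp add: nn_integral_eq_integral_Lp[OF f])
qed

lemma distr_fun_finite:
  assumes "0 < p" "f \<in> Lp_space M p" "0 < t"
  shows "distr_fun M f t < \<infinity>"
proof (rule ccontr)
  assume "\<not> ?thesis"
  hence "distr_fun M f t = \<infinity>" by (simp add: less_top[symmetric])
  with distr_fun_le_Lp[OF assms] assms(3) show False by (simp add: ennreal_mult_top top_unique)
qed

text \<open>The measure M itself may fail to be sigma-finite, but its restriction to the set where f does not
  vanish is exhausted by the superlevel sets, which have finite measure; Tonelli's theorem is applied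
  to that restriction.\<close>

lemma nn_integral_layer_cake:
  fixes f :: "real \<Rightarrow> real"
  assumes p: "0 < p" and f[measurable]: "f \<in> borel_measurable M"
    and fin: "\<And>t. 0 < t \<Longrightarrow> distr_fun M f t < \<infinity>"
  shows "(\<integral>\<^sup>+x. ennreal (\<bar>f x\<bar> powr p) \<partial>M)
       = (\<integral>\<^sup>+t\<in>{0<..}. ennreal (p * t powr (p - 1)) * distr_fun M f t \<partial>lborel)"
proof -
  define S where "S = {x \<in> space M. f x \<noteq> 0}"
  have [measurable]: "S \<in> sets M" unfolding S_def by measurable
  define M' where "M' = density M (indicator S)"
  have [simp, measurable_cong]: "sets M' = sets M" by (simp add: M'_def)
  have [simp]: "space M' = space M" by (simp add: M'_def)
  have em: "emeasure M' A = emeasure M (S \<inter> A)" if "A \<in> sets M" for A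
  proof -
    have "emeasure M' A = (\<integral>\<^sup>+x. indicator S x * indicator A x \<partial>M)"
      unfolding M'_def using that by (intro emeasure_density) auto
    also have "\<dots> = (\<integral>\<^sup>+x. indicator (S \<inter> A) x \<partial>M)"
      by (intro nn_integral_cong) (auto simp: indicator_def)
    also have "\<dots> = emeasure M (S \<inter> A)" using that by (intro nn_integral_indicator) auto
    finally show ?thesis .
  qed
  have lv: "S \<inter> {x \<in> space M. t \<le> \<bar>f x\<bar>} = {x \<in> space M. t \<le> \<bar>f x\<bar>}" if "0 < t" for t
    using that by (auto simp: S_def)
  interpret M': sigma_finite_measure M'
  proof
    let ?A = "insert (space M - S) (range (\<lambda>n. {x \<in> space M. inverse (real (Suc n)) \<le> \<bar>f x\<bar>}))"
    have "x \<in> \<Union> ?A" if "x \<in> space M" for x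
    proof (cases "f x = 0")
      case False
      then obtain n where "inverse (real (Suc n)) < \<bar>f x\<bar>" using reals_Archimedean[of "\<bar>f x\<bar>"] by auto
      thus ?thesis using that by (auto intro!: exI[of _ n])
    qed (use that in \<open>auto simp: S_def\<close>)
    hence "\<Union> ?A = space M'" using sets.sets_into_space by auto
    moreover have "emeasure M' (space M - S) = 0" by (subst em) auto
    moreover have "emeasure M' {x \<in> space M. inverse (real (Suc n)) \<le> \<bar>f x\<bar>} \<noteq> \<infinity>" for n
      using fin[of "inverse (real (Suc n))"] by (subst em) (auto simp: lv distr_fun_def)
    ultimately show "\<exists>A. countable A \<and> A \<subseteq> sets M' \<and> \<Union> A = space M' \<and> (\<forall>a\<in>A. emeasure M' a \<noteq> \<infinity>)"
      by (intro exI[of _ ?A]) auto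
  qed
  interpret P: pair_sigma_finite M' lborel ..
  let ?F = "\<lambda>x t. ennreal (p * t powr (p - 1)) * indicator {0<..\<bar>f x\<bar>} t"
  have inner: "(\<integral>\<^sup>+t. ?F x t \<partial>lborel) = ennreal (\<bar>f x\<bar> powr p)" for x
  proof -
    have "((\<lambda>t. p * t powr (p - 1)) has_integral p * (\<bar>f x\<bar> powr (p - 1 + 1) / (p - 1 + 1))) {0..\<bar>f x\<bar>}"
      using p by (intro has_integral_mult_right has_integral_powr_from_0) auto
    hence "((\<lambda>t. p * t powr (p - 1)) has_integral \<bar>f x\<bar> powr p) {0..\<bar>f x\<bar>}" using p by simp
    from nn_integral_has_integral_lebesgue'[OF _ this] p
    have "(\<integral>\<^sup>+t. ennreal (p * t powr (p - 1)) * indicator {0..\<bar>f x\<bar>} t \<partial>lborel) = ennreal (\<bar>f x\<bar> powr p)" by simp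
    moreover have "?F x t = ennreal (p * t powr (p - 1)) * indicator {0..\<bar>f x\<bar>} t" for t
      by (auto simp: indicator_def)
    ultimately show ?thesis by simp
  qed
  have "(\<integral>\<^sup>+x. ennreal (\<bar>f x\<bar> powr p) \<partial>M) = (\<integral>\<^sup>+x. indicator S x * ennreal (\<bar>f x\<bar> powr p) \<partial>M)"
    by (intro nn_integral_cong) (auto simp: S_def indicator_def)
  also have "\<dots> = (\<integral>\<^sup>+x. ennreal (\<bar>f x\<bar> powr p) \<partial>M')"
    unfolding M'_def by (subst nn_integral_density) auto
  also have "\<dots> = (\<integral>\<^sup>+x. (\<integral>\<^sup>+t. ?F x t \<partial>lborel) \<partial>M')" by (simp add: inner)
  also have "\<dots> = (\<integral>\<^sup>+t. (\<integral>\<^sup>+x. ?F x t \<partial>M') \<partial>lborel)"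
  proof (rule P.Fubini'[symmetric])
    have "(\<lambda>(x, t). ennreal (p * t powr (p - 1)) * (if 0 < t \<and> t \<le> \<bar>f x\<bar> then 1 else 0))
       \<in> borel_measurable (M' \<Otimes>\<^sub>M lborel)" by measurable
    thus "(\<lambda>(x, t). ?F x t) \<in> borel_measurable (M' \<Otimes>\<^sub>M lborel)" by (simp add: indicator_def)
  qed
  also have "\<dots> = (\<integral>\<^sup>+t\<in>{0<..}. ennreal (p * t powr (p - 1)) * distr_fun M f t \<partial>lborel)"
  proof (intro nn_integral_cong)
    fix t :: real
    show "(\<integral>\<^sup>+x. ?F x t \<partial>M') = ennreal (p * t powr (p - 1)) * distr_fun M f t * indicator {0<..} t"
    proof (cases "0 < t")
      case True
      have "(\<integral>\<^sup>+x. ?F x t \<partial>M') = (\<integral>\<^sup>+x. ennreal (p * t powr (p - 1)) * indicator {x \<in> space M. t \<le> \<bar>f x\<bar>} x \<partial>M')"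
        using True by (intro nn_integral_cong) (auto simp: indicator_def)
      also have "\<dots> = ennreal (p * t powr (p - 1)) * emeasure M' {x \<in> space M. t \<le> \<bar>f x\<bar>}"
        by (subst nn_integral_cmult_indicator) auto
      also have "\<dots> = ennreal (p * t powr (p - 1)) * distr_fun M f t"
        using True by (subst em) (auto simp: lv distr_fun_def)
      finally show ?thesis using True by simp
    qed (auto simp: indicator_def)
  qed
  finally show ?thesis .
qed

section \<open>Lorentz norms between weak and Lebesgue norms\<close>

lemma borel_measurable_antimono_on:
  fixes f :: "real \<Rightarrow> real"
  assumes "antimono_on A f"
  shows "f \<in> borel_measurable (restrict_space borel A)"
proof -
  have "mono_on A (\<lambda>x. - f x)" using assms by (auto simp: monotone_on_def)
  from borel_measurable_uminus[OF borel_measurable_mono_on_fnc[OF this]] show ?thesis by simp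
qed

lemma distr_fun_measurable_real:
  assumes gm: "g \<in> borel_measurable M" and fin: "\<And>t. 0 < t \<Longrightarrow> distr_fun M g t < \<infinity>"
  shows "(\<lambda>t. if 0 < t then enn2real (distr_fun M g t) else 0) \<in> borel_measurable borel"
proof -
  have "antimono_on {0<..} (\<lambda>t. enn2real (distr_fun M g t))"
  proof (rule monotone_onI)
    fix t u :: real assume "t \<in> {0<..}" "u \<in> {0<..}" "t \<le> u"
    moreover have "distr_fun M g u \<le> distr_fun M g t" unfolding distr_fun_def
      using \<open>t \<le> u\<close> superlevel_set_measurable[OF gm] by (intro emeasure_mono) auto
    ultimately show "enn2real (distr_fun M g u) \<le> enn2real (distr_fun M g t)"
      using fin[of t] by (intro enn2real_mono) auto
  qed
  from borel_measurable_antimono_on[OF this] show ?thesis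
    by (subst (asm) measurable_restrict_space_iff[where c = 0]) auto
qed

lemma ennpowr_ennreal [simp]: "0 \<le> x \<Longrightarrow> ennpowr (ennreal x) a = ennreal (x powr a)"
  by (simp add: ennpowr_def)

lemma lorentz_integrand:
  assumes "0 < t" "distr_fun M f t < \<infinity>"
  defines "D \<equiv> enn2real (distr_fun M f t)"
  shows "ennpowr (ennpowr (distr_fun M f t) (1 / p) * ennreal t) s / ennreal t
       = ennreal ((D powr (1 / p) * t) powr s / t)"
proof -
  have D: "0 \<le> D" "distr_fun M f t = ennreal D" using assms by (auto simp: less_top)
  have "ennpowr (ennreal D) (1 / p) * ennreal t = ennreal (D powr (1 / p) * t)"
    using D assms(1) by (simp add: ennreal_mult)
  moreover have "ennpowr (ennreal (D powr (1 / p) * t)) s = ennreal ((D powr (1 / p) * t) powr s)"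
    using assms(1) by (intro ennpowr_ennreal) auto
  ultimately show ?thesis using D(2) assms(1) by (simp add: divide_ennreal)
qed

text \<open>Interpolation of the Lorentz space between the weak space and the Lebesgue space: of the p +
  \<delta> factors in the integrand, \<delta> are estimated by the bound K on the weak norm, and the remaining
  integral is the layer cake formula. For a function of unit norm the Lorentz norm is thus small as
  soon as the weak norm is.\<close>

lemma lorentz_norm_le_weak_norm:
  assumes p: "0 < p" and \<delta>: "0 < \<delta>" and K: "0 \<le> K" and f: "f \<in> Lp_space M p"
    and weak: "\<And>t. 0 < t \<Longrightarrow> enn2real (distr_fun M f t) powr (1 / p) * t \<le> K"
  shows "f \<in> lorentz_space M p (p + \<delta>)"
    and "lorentz_norm M p (p + \<delta>) f \<le> (K powr \<delta> / p * (\<integral>x. \<bar>f x\<bar> powr p \<partial>M)) powr (1 / (p + \<delta>))"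
proof -
  define I where "I = (\<integral>x. \<bar>f x\<bar> powr p \<partial>M)"
  define J where "J = (\<integral>\<^sup>+t\<in>{0<..}. ennpowr (ennpowr (distr_fun M f t) (1 / p) * ennreal t) (p + \<delta>) / ennreal t \<partial>lborel)"
  have fm: "f \<in> borel_measurable M" using f by (simp add: Lp_space_def)
  note fin = distr_fun_finite[OF p f]
  have "J \<le> (\<integral>\<^sup>+t. ennreal (K powr \<delta> / p) * (ennreal (p * t powr (p - 1)) * distr_fun M f t * indicator {0<..} t) \<partial>lborel)"
    unfolding J_def
  proof (intro nn_integral_mono)
    fix t :: real
    show "ennpowr (ennpowr (distr_fun M f t) (1 / p) * ennreal t) (p + \<delta>) / ennreal t * indicator {0<..} t
       \<le> ennreal (K powr \<delta> / p) * (ennreal (p * t powr (p - 1)) * distr_fun M f t * indicator {0<..} t)"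
    proof (cases "0 < t")
      case True
      define D where "D = enn2real (distr_fun M f t)"
      have D: "0 \<le> D" "distr_fun M f t = ennreal D"
        unfolding D_def using ennreal_enn2real[of "distr_fun M f t"] fin[OF True] by auto
      have "(D powr (1 / p) * t) powr (p + \<delta>) / t = (D powr (1 / p) * t) powr \<delta> * ((D powr (1 / p) * t) powr p / t)"
        by (simp add: powr_add)
      also have "(D powr (1 / p) * t) powr p / t = D * t powr (p - 1)"
        using D True p by (simp add: powr_mult powr_powr powr_diff)
      also have "(D powr (1 / p) * t) powr \<delta> * (D * t powr (p - 1)) \<le> K powr \<delta> * (D * t powr (p - 1))"
        using weak[OF True, folded D_def] D(1) True \<delta> by (intro mult_right_mono powr_mono2) auto
      also have "\<dots> = K powr \<delta> / p * (p * t powr (p - 1) * D)" using p by simp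
      finally have "ennreal ((D powr (1 / p) * t) powr (p + \<delta>) / t) \<le> ennreal (K powr \<delta> / p * (p * t powr (p - 1) * D))"
        by (rule ennreal_leI)
      also have "\<dots> = ennreal (K powr \<delta> / p) * (ennreal (p * t powr (p - 1)) * ennreal D)"
      proof -
        have "ennreal (p * t powr (p - 1) * D) = ennreal (p * t powr (p - 1)) * ennreal D"
          using p D(1) by (intro ennreal_mult) auto
        moreover have "ennreal (K powr \<delta> / p * (p * t powr (p - 1) * D))
            = ennreal (K powr \<delta> / p) * ennreal (p * t powr (p - 1) * D)"
          using p D(1) by (intro ennreal_mult) auto
        ultimately show ?thesis by (simp only:)
      qed
      finally show ?thesis using True lorentz_integrand[OF True fin[OF True]] D(2)
        unfolding D_def[symmetric] by simp
    qed simp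
  qed
  also have "\<dots> = ennreal (K powr \<delta> / p) * (\<integral>\<^sup>+t. ennreal (p * t powr (p - 1)) * distr_fun M f t * indicator {0<..} t \<partial>lborel)"
  proof (intro nn_integral_cmult)
    have "(\<lambda>t. ennreal (p * t powr (p - 1)) * ennreal (if 0 < t then enn2real (distr_fun M f t) else 0) * indicator {0<..} t) \<in> borel_measurable borel"
      using distr_fun_measurable_real[OF fm fin] by measurable
    also have "(\<lambda>t. ennreal (p * t powr (p - 1)) * ennreal (if 0 < t then enn2real (distr_fun M f t) else 0) * indicator {0<..} t)
      = (\<lambda>t. ennreal (p * t powr (p - 1)) * distr_fun M f t * indicator {0<..} t)"
      using ennreal_enn2real[of "distr_fun M f _"] fin by (auto simp: indicator_def fun_eq_iff)
    finally show "(\<lambda>t. ennreal (p * t powr (p - 1)) * distr_fun M f t * indicator {0<..} t) \<in> borel_measurable lborel" by simp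
  qed
  also have "\<dots> = ennreal (K powr \<delta> / p) * ennreal I"
    using nn_integral_layer_cake[OF p fm fin] nn_integral_eq_integral_Lp[OF f] by (simp add: I_def)
  also have "\<dots> = ennreal (K powr \<delta> / p * I)"
    using p by (intro ennreal_mult[symmetric]) (auto simp: I_def)
  finally have J: "J \<le> ennreal (K powr \<delta> / p * I)" .
  then obtain j where j: "0 \<le> j" "J = ennreal j" by (cases J) (auto simp: top_unique)
  have jle: "j \<le> K powr \<delta> / p * I" using J j p by (simp add: I_def)
  have eq: "lorentz_ennnorm M p (p + \<delta>) f = ennreal (j powr (1 / (p + \<delta>)))"
    using j unfolding lorentz_ennnorm_def J_def[symmetric] by simp
  show "f \<in> lorentz_space M p (p + \<delta>)" using fm eq by (simp add: lorentz_space_def)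
  have "j powr (1 / (p + \<delta>)) \<le> (K powr \<delta> / p * I) powr (1 / (p + \<delta>))"
    using jle j p \<delta> by (intro powr_mono2) auto
  thus "lorentz_norm M p (p + \<delta>) f \<le> (K powr \<delta> / p * (\<integral>x. \<bar>f x\<bar> powr p \<partial>M)) powr (1 / (p + \<delta>))"
    using eq by (simp add: lorentz_norm_def I_def)
qed

text \<open>The embedding of Lorentz spaces with increasing second exponent. As the distribution function
  decreases, the integrand on (0,t] already controls its value at t, which bounds the weak norm by
  the Lorentz norm; the surplus q - s of the powers in the layer cake formula is estimated by the weak
  norm.\<close>

lemma Lp_le_lorentz_norm:
  assumes s: "0 < s" "s < q" and g: "g \<in> Lp_space M q" "g \<in> lorentz_space M q s"
  shows "(\<integral>x. \<bar>g x\<bar> powr q \<partial>M) \<le> q * s powr ((q - s) / s) * lorentz_norm M q s g powr q"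
proof -
  have q: "0 < q" using s by simp
  define J where "J = (\<integral>\<^sup>+t\<in>{0<..}. ennpowr (ennpowr (distr_fun M g t) (1 / q) * ennreal t) s / ennreal t \<partial>lborel)"
  define D where "D t = enn2real (distr_fun M g t)" for t
  have gm: "g \<in> borel_measurable M" using g by (simp add: Lp_space_def)
  note fin = distr_fun_finite[OF q g(1)]
  have D: "0 \<le> D t" "0 < t \<Longrightarrow> distr_fun M g t = ennreal (D t)" for t
    using fin[of t] by (auto simp: D_def less_top)
  have Dmeas: "(\<lambda>t. if 0 < t then D t else 0) \<in> borel_measurable borel"
    unfolding D_def using fin by (rule distr_fun_measurable_real[OF gm])
  have J: "J = (\<integral>\<^sup>+t. ennreal ((D t powr (1 / q) * t) powr s / t) * indicator {0<..} t \<partial>lborel)"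
    unfolding J_def using lorentz_integrand[OF _ fin] by (intro nn_integral_cong) (auto simp: indicator_def D_def)
  have ennnorm: "lorentz_ennnorm M q s g = ennpowr J (1 / s)" by (simp add: lorentz_ennnorm_def J_def)
  have "J \<noteq> \<infinity>"
  proof
    assume "J = \<infinity>"
    hence "lorentz_ennnorm M q s g = \<infinity>" using ennnorm by (simp add: ennpowr_def)
    thus False using g(2) by (simp add: lorentz_space_def)
  qed
  then obtain j where j: "0 \<le> j" "J = ennreal j" by (cases J) auto
  have norm: "lorentz_norm M q s g = j powr (1 / s)"
    using j ennnorm by (simp add: lorentz_norm_def)
  have weak: "(D t powr (1 / q) * t) powr s \<le> s * j" if t: "0 < t" for t
  proof -
    have "((\<lambda>u. D t powr (s / q) * u powr (s - 1)) has_integral D t powr (s / q) * (t powr (s - 1 + 1) / (s - 1 + 1))) {0..t}"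
      using s t by (intro has_integral_mult_right has_integral_powr_from_0) auto
    from nn_integral_has_integral_lebesgue'[OF _ this] have
      "ennreal (D t powr (s / q) * (t powr s / s)) = (\<integral>\<^sup>+u. ennreal (D t powr (s / q) * u powr (s - 1)) * indicator {0..t} u \<partial>lborel)"
      by simp
    also have "\<dots> \<le> J" unfolding J
    proof (intro nn_integral_mono)
      fix u :: real
      show "ennreal (D t powr (s / q) * u powr (s - 1)) * indicator {0..t} u
         \<le> ennreal ((D u powr (1 / q) * u) powr s / u) * indicator {0<..} u"
      proof (cases "0 < u \<and> u \<le> t")
        case True
        have "distr_fun M g t \<le> distr_fun M g u" unfolding distr_fun_def
          using True superlevel_set_measurable[OF gm] by (intro emeasure_mono) auto
        hence "D t \<le> D u" using D True t by simp
        hence "D t powr (s / q) * u powr (s - 1) \<le> D u powr (s / q) * u powr (s - 1)"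
          using D s by (intro mult_right_mono powr_mono2) auto
        also have "\<dots> = (D u powr (1 / q) * u) powr s / u"
          using D True by (simp add: powr_mult powr_powr powr_diff)
        finally show ?thesis using True by (auto intro: ennreal_leI)
      qed (use s in \<open>auto simp: indicator_def not_less\<close>)
    qed
    finally have "D t powr (s / q) * (t powr s / s) \<le> j" using j by simp
    thus ?thesis using s D t by (simp add: powr_mult powr_powr field_simps)
  qed
  define c where "c = q * (s * j) powr ((q - s) / s)"
  have c0: "0 \<le> c" using q by (simp add: c_def)
  have "ennreal (\<integral>x. \<bar>g x\<bar> powr q \<partial>M) = (\<integral>\<^sup>+t\<in>{0<..}. ennreal (q * t powr (q - 1)) * distr_fun M g t \<partial>lborel)"
    using nn_integral_layer_cake[OF q gm fin] nn_integral_eq_integral_Lp[OF g(1)] by simp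
  also have "\<dots> \<le> (\<integral>\<^sup>+t. ennreal c * (ennreal ((D t powr (1 / q) * t) powr s / t) * indicator {0<..} t) \<partial>lborel)"
  proof (intro nn_integral_mono)
    fix t :: real
    show "ennreal (q * t powr (q - 1)) * distr_fun M g t * indicator {0<..} t
       \<le> ennreal c * (ennreal ((D t powr (1 / q) * t) powr s / t) * indicator {0<..} t)"
    proof (cases "0 < t")
      case True
      define y where "y = D t powr (1 / q) * t"
      have y0: "0 \<le> y" using True by (simp add: y_def)
      have "q * t powr (q - 1) * D t = q * (y powr q / t)"
        using True D q by (simp add: y_def powr_mult powr_powr powr_diff)
      also have "y powr q = (y powr s) powr ((q - s) / s) * y powr s"
        using s by (simp add: powr_powr powr_add[symmetric])
      also have "q * ((y powr s) powr ((q - s) / s) * y powr s / t) \<le> q * ((s * j) powr ((q - s) / s) * y powr s / t)"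
        using weak[OF True] True s q
        by (intro mult_left_mono divide_right_mono mult_right_mono powr_mono2) (auto simp: y_def)
      also have "\<dots> = c * (y powr s / t)" by (simp add: c_def)
      finally have "ennreal (q * t powr (q - 1) * D t) \<le> ennreal (c * (y powr s / t))" by (rule ennreal_leI)
      also have "ennreal (q * t powr (q - 1) * D t) = ennreal (q * t powr (q - 1)) * distr_fun M g t"
        unfolding D(2)[OF True] using D(1) q by (intro ennreal_mult) auto
      also have "ennreal (c * (y powr s / t)) = ennreal c * ennreal (y powr s / t)"
        using c0 True by (intro ennreal_mult) auto
      finally show ?thesis using True by (simp add: y_def)
    qed simp
  qed
  also have "\<dots> = ennreal c * J" unfolding J
  proof (intro nn_integral_cmult)
    have "(\<lambda>t. ennreal (((if 0 < t then D t else 0) powr (1 / q) * t) powr s / t) * indicator {0<..} t) \<in> borel_measurable borel"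
      using Dmeas by measurable
    also have "(\<lambda>t. ennreal (((if 0 < t then D t else 0) powr (1 / q) * t) powr s / t) * indicator {0<..} t)
      = (\<lambda>t. ennreal ((D t powr (1 / q) * t) powr s / t) * indicator {0<..} t)"
      by (auto simp: indicator_def fun_eq_iff)
    finally show "(\<lambda>t. ennreal ((D t powr (1 / q) * t) powr s / t) * indicator {0<..} t) \<in> borel_measurable lborel" by simp
  qed
  also have "\<dots> = ennreal (c * j)" using j c0 by (simp add: ennreal_mult)
  finally have "(\<integral>x. \<bar>g x\<bar> powr q \<partial>M) \<le> c * j" using c0 j by simp
  also have "c * j = q * s powr ((q - s) / s) * (j powr ((q - s) / s) * j)"
    using s j by (simp add: c_def powr_mult)
  also have "j powr ((q - s) / s) * j = (j powr (1 / s)) powr q"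
  proof (cases "j = 0")
    case False
    have "j powr ((q - s) / s) * j powr 1 = j powr ((q - s) / s + 1)" by (rule powr_add[symmetric])
    also have "(q - s) / s + 1 = q / s" using s by (simp add: field_simps)
    finally show ?thesis using j by (simp add: powr_powr)
  qed (use q s in auto)
  finally show ?thesis by (simp add: norm)
qed

section \<open>The radial measure, dilations and rearrangements\<close>

lemma space_radial_measure [simp]: "space (radial_measure m) = {0<..}"
  by (simp add: radial_measure_def space_restrict_space)

lemma sets_radial_measure [simp, measurable_cong]:
  "sets (radial_measure m) = sets (restrict_space borel {0<..})"
  by (simp add: radial_measure_def sets_restrict_space)

lemma nn_integral_radial_measure:
  assumes [measurable]: "f \<in> borel_measurable (radial_measure m)"
  shows "(\<integral>\<^sup>+r. f r \<partial>radial_measure m)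
       = (\<integral>\<^sup>+r. ennreal (r powr of_int (m - 1)) * (f r * indicator {0<..} r) \<partial>lborel)"
proof -
  have [measurable]: "f \<in> borel_measurable (restrict_space lborel {0<..})"
    using assms by (simp add: measurable_cong_sets[OF sets_restrict_space_cong[OF sets_lborel] refl]
        measurable_cong_sets[OF sets_radial_measure refl])
  have [measurable]: "(\<lambda>r. ennreal (r powi (m - 1))) \<in> borel_measurable (restrict_space lborel {0<..})"
  proof -
    have "(\<lambda>r::real. ennreal (r powr of_int (m - 1))) \<in> borel_measurable (restrict_space lborel {0<..})"
      by (intro measurable_restrict_space1) simp
    also have "?this \<longleftrightarrow> ?thesis"
      by (intro measurable_cong) (auto simp: space_restrict_space powr_real_of_int' simp del: of_int_diff)
    finally show ?thesis .
  qed
  have "(\<integral>\<^sup>+r. f r \<partial>radial_measure m)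
      = (\<integral>\<^sup>+r. ennreal (r powi (m - 1)) * f r \<partial>restrict_space lborel {0<..})"
    unfolding radial_measure_def by (intro nn_integral_density) auto
  also have "\<dots> = (\<integral>\<^sup>+r. ennreal (r powi (m - 1)) * f r * indicator {0<..} r \<partial>lborel)"
    by (intro nn_integral_restrict_space) auto
  also have "\<dots> = (\<integral>\<^sup>+r. ennreal (r powr of_int (m - 1)) * (f r * indicator {0<..} r) \<partial>lborel)"
    by (intro nn_integral_cong) (auto simp: indicator_def powr_real_of_int' mult.assoc simp del: of_int_diff)
  finally show ?thesis .
qed

lemma measurable_radial_scale:
  fixes f :: "real \<Rightarrow> 'b::topological_space"
  assumes "0 < c" and f: "f \<in> borel_measurable (radial_measure m)"
  shows "(\<lambda>r. f (c * r)) \<in> borel_measurable (radial_measure m)"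
proof -
  have "(\<lambda>r. c * r) \<in> measurable (restrict_space borel {0<..}) (restrict_space borel {0<..})"
    using assms(1) by (intro measurable_restrict_space3) auto
  hence "(\<lambda>r. c * r) \<in> measurable (radial_measure m) (radial_measure m)"
    by (simp add: measurable_cong_sets[OF sets_radial_measure sets_radial_measure])
  from measurable_compose[OF this f] show ?thesis .
qed

text \<open>The measure is homogeneous of degree m under dilations.\<close>

lemma nn_integral_radial_scale:
  fixes f :: "real \<Rightarrow> ennreal"
  assumes c: "0 < c" and f: "f \<in> borel_measurable (radial_measure m)"
  shows "(\<integral>\<^sup>+r. f r \<partial>radial_measure m) = ennreal (c powr of_int m) * (\<integral>\<^sup>+r. f (c * r) \<partial>radial_measure m)"
proof -
  have [measurable]: "(\<lambda>r. f r * indicator {0<..} r) \<in> borel_measurable borel"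
    using f by (subst borel_measurable_restrict_space_iff_ennreal[symmetric])
      (auto simp: measurable_cong_sets[OF sets_radial_measure refl])
  have f': "(\<lambda>r. f (c * r) * indicator {0<..} (c * r)) \<in> borel_measurable borel" by measurable
  have "(\<integral>\<^sup>+r. f r \<partial>radial_measure m)
      = (\<integral>\<^sup>+r. ennreal (r powr of_int (m - 1)) * (f r * indicator {0<..} r) \<partial>lborel)"
    by (rule nn_integral_radial_measure[OF f])
  also have "\<dots> = ennreal c * (\<integral>\<^sup>+r. ennreal ((c * r) powr of_int (m - 1)) * (f (c * r) * indicator {0<..} (c * r)) \<partial>lborel)"
    using c by (subst nn_integral_real_affine[where c = c and t = 0]) auto
  also have "\<dots> = (\<integral>\<^sup>+r. ennreal c * (ennreal ((c * r) powr of_int (m - 1)) * (f (c * r) * indicator {0<..} (c * r))) \<partial>lborel)"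
    using f' by (intro nn_integral_cmult[symmetric]) measurable
  also have "\<dots> = (\<integral>\<^sup>+r. ennreal (c powr of_int m) * (ennreal (r powr of_int (m - 1)) * (f (c * r) * indicator {0<..} r)) \<partial>lborel)"
  proof (intro nn_integral_cong)
    fix r :: real
    show "ennreal c * (ennreal ((c * r) powr of_int (m - 1)) * (f (c * r) * indicator {0<..} (c * r)))
       = ennreal (c powr of_int m) * (ennreal (r powr of_int (m - 1)) * (f (c * r) * indicator {0<..} r))"
    proof (cases "0 < r")
      case True
      have "c * (c * r) powr of_int (m - 1) = c powr of_int m * r powr of_int (m - 1)"
        using True c by (simp add: powr_mult powr_diff)
      hence "ennreal c * ennreal ((c * r) powr of_int (m - 1)) = ennreal (c powr of_int m) * ennreal (r powr of_int (m - 1))"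
        using c True by (simp add: ennreal_mult[symmetric])
      thus ?thesis using True c by (simp add: mult.assoc[symmetric])
    qed (use c in \<open>auto simp: indicator_def zero_less_mult_iff\<close>)
  qed
  also have "\<dots> = ennreal (c powr of_int m) * (\<integral>\<^sup>+r. ennreal (r powr of_int (m - 1)) * (f (c * r) * indicator {0<..} r) \<partial>lborel)"
  proof (intro nn_integral_cmult)
    have "(\<lambda>r. f (c * r) * indicator {0<..} r) \<in> borel_measurable borel"
      using f' c by (simp add: indicator_def zero_less_mult_iff)
    thus "(\<lambda>r. ennreal (r powr of_int (m - 1)) * (f (c * r) * indicator {0<..} r)) \<in> borel_measurable lborel" by measurable
  qed
  also have "\<dots> = ennreal (c powr of_int m) * (\<integral>\<^sup>+r. f (c * r) \<partial>radial_measure m)"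
    using nn_integral_radial_measure[OF measurable_radial_scale[OF c f]] by simp
  finally show ?thesis .
qed

lemma emeasure_radial_Ioc:
  assumes "1 \<le> m" "0 < x"
  shows "emeasure (radial_measure m) {0<..x} = ennreal (x powr of_int m / of_int m)"
proof -
  have S: "{0<..x} \<in> sets (radial_measure m)"
    by (simp add: sets_restrict_space_iff subset_eq)
  have "emeasure (radial_measure m) {0<..x} = (\<integral>\<^sup>+r. indicator {0<..x} r \<partial>radial_measure m)"
    using S by simp
  also have "\<dots> = (\<integral>\<^sup>+r. ennreal (r powr of_int (m - 1)) * (indicator {0<..x} r * indicator {0<..} r) \<partial>lborel)"
    using S by (intro nn_integral_radial_measure) auto
  also have "\<dots> = (\<integral>\<^sup>+r. ennreal (r powr of_int (m - 1)) * indicator {0..x} r \<partial>lborel)"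
    by (intro nn_integral_cong) (auto simp: indicator_def)
  also have "\<dots> = ennreal (x powr (of_int (m - 1) + 1) / (of_int (m - 1) + 1))"
    using assms by (intro nn_integral_has_integral_lebesgue' has_integral_powr_from_0) auto
  finally show ?thesis by simp
qed

lemma dilation_Lp:
  assumes p: "0 < p" and c: "0 < c" and f: "f \<in> Lp_space (radial_measure m) p"
  shows "dilation m p c f \<in> Lp_space (radial_measure m) p"
    and "Lp_norm (radial_measure m) p (dilation m p c f) = Lp_norm (radial_measure m) p f"
proof -
  have [measurable]: "f \<in> borel_measurable (radial_measure m)" using f by (simp add: Lp_space_def)
  have [measurable]: "(\<lambda>r. f (c * r)) \<in> borel_measurable (radial_measure m)"
    by (rule measurable_radial_scale[OF c]) measurable
  have meas: "dilation m p c f \<in> borel_measurable (radial_measure m)"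
    unfolding dilation_def by measurable
  have "(\<integral>\<^sup>+r. ennreal (\<bar>dilation m p c f r\<bar> powr p) \<partial>radial_measure m)
      = (\<integral>\<^sup>+r. ennreal (c powr of_int m) * ennreal (\<bar>f (c * r)\<bar> powr p) \<partial>radial_measure m)"
    using p c by (intro nn_integral_cong)
      (simp add: dilation_def abs_mult powr_mult powr_powr ennreal_mult[symmetric])
  also have "\<dots> = ennreal (c powr of_int m) * (\<integral>\<^sup>+r. ennreal (\<bar>f (c * r)\<bar> powr p) \<partial>radial_measure m)"
    by (intro nn_integral_cmult) measurable
  also have "\<dots> = (\<integral>\<^sup>+r. ennreal (\<bar>f r\<bar> powr p) \<partial>radial_measure m)"
    by (rule nn_integral_radial_scale[OF c, symmetric]) measurable
  finally have eq: "(\<integral>\<^sup>+r. ennreal (\<bar>dilation m p c f r\<bar> powr p) \<partial>radial_measure m)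
      = (\<integral>\<^sup>+r. ennreal (\<bar>f r\<bar> powr p) \<partial>radial_measure m)" .
  show "dilation m p c f \<in> Lp_space (radial_measure m) p"
    using f meas eq by (simp add: Lp_space_iff_nn_integral)
  show "Lp_norm (radial_measure m) p (dilation m p c f) = Lp_norm (radial_measure m) p f"
    using meas eq by (simp add: Lp_norm_eq_nn_integral)
qed

text \<open>By the layer cake formula the norm depends on the distribution function only.\<close>

lemma rearrangement_Lp:
  assumes p: "0 < p" and f: "f \<in> Lp_space (radial_measure m) p" and g: "nonincr_rearrangement m f g"
  shows "g \<in> Lp_space (radial_measure m) p"
    and "Lp_norm (radial_measure m) p g = Lp_norm (radial_measure m) p f"
proof -
  have fm: "f \<in> borel_measurable (radial_measure m)" using f by (simp add: Lp_space_def)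
  have g0: "antimono_on {0<..} g" "\<And>r. 0 < r \<Longrightarrow> 0 \<le> g r" using g by (auto simp: nonincr_rearrangement_def)
  have gm: "g \<in> borel_measurable (radial_measure m)"
    using borel_measurable_antimono_on[OF g0(1)] by (simp add: measurable_cong_sets[OF sets_radial_measure refl])
  have d: "distr_fun (radial_measure m) g t = distr_fun (radial_measure m) f t" if "0 < t" for t
  proof -
    have "{r \<in> {0<..}. t \<le> \<bar>g r\<bar>} = {r \<in> {0<..}. t \<le> g r}" using g0(2) by (auto simp: abs_of_nonneg)
    thus ?thesis using g that by (simp add: distr_fun_def nonincr_rearrangement_def)
  qed
  have "(\<integral>\<^sup>+r. ennreal (\<bar>g r\<bar> powr p) \<partial>radial_measure m)
     = (\<integral>\<^sup>+t\<in>{0<..}. ennreal (p * t powr (p - 1)) * distr_fun (radial_measure m) g t \<partial>lborel)"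
    using d distr_fun_finite[OF p f] by (intro nn_integral_layer_cake p gm) auto
  also have "\<dots> = (\<integral>\<^sup>+t\<in>{0<..}. ennreal (p * t powr (p - 1)) * distr_fun (radial_measure m) f t \<partial>lborel)"
    by (intro nn_integral_cong) (auto simp: d indicator_def)
  also have "\<dots> = (\<integral>\<^sup>+r. ennreal (\<bar>f r\<bar> powr p) \<partial>radial_measure m)"
    using distr_fun_finite[OF p f] by (intro nn_integral_layer_cake[symmetric] p fm) auto
  finally have eq: "(\<integral>\<^sup>+r. ennreal (\<bar>g r\<bar> powr p) \<partial>radial_measure m) = (\<integral>\<^sup>+r. ennreal (\<bar>f r\<bar> powr p) \<partial>radial_measure m)" .
  show "g \<in> Lp_space (radial_measure m) p" using f gm eq by (simp add: Lp_space_iff_nn_integral)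
  show "Lp_norm (radial_measure m) p g = Lp_norm (radial_measure m) p f"
    using fm gm eq by (simp add: Lp_norm_eq_nn_integral)
qed

text \<open>A decreasing function with a negative value stays away from 0 on a half-line, which has
  infinite measure when the dimension is positive.\<close>

lemma antimono_Lp_nonneg:
  assumes m: "1 \<le> m" and p: "0 < p" and f: "f \<in> Lp_space (radial_measure m) p"
    and mono: "antimono_on {0<..} f" and r: "0 < r"
  shows "0 \<le> f r"
proof (rule ccontr)
  assume "\<not> 0 \<le> f r"
  define t where "t = - f r"
  have t: "0 < t" using \<open>\<not> 0 \<le> f r\<close> by (simp add: t_def)
  have fm: "f \<in> borel_measurable (radial_measure m)" using f by (simp add: Lp_space_def)
  have S: "{0<..x} \<in> sets (radial_measure m)" for x by (simp add: sets_restrict_space_iff subset_eq)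
  have S': "{x \<in> {0<..}. t \<le> \<bar>f x\<bar>} \<in> sets (radial_measure m)"
    using superlevel_set_measurable[OF fm, of t] unfolding space_radial_measure .
  have "distr_fun (radial_measure m) f t < \<infinity>" using p f t by (rule distr_fun_finite)
  then obtain K where K: "K \<ge> 0" "distr_fun (radial_measure m) f t = ennreal K"
    by (cases "distr_fun (radial_measure m) f t") auto
  define L where "L = K + r powr of_int m / of_int m"
  have "x powr of_int m / of_int m \<le> L" if x: "0 < x" for x
  proof -
    have "{0<..x} \<subseteq> {x \<in> {0<..}. t \<le> \<bar>f x\<bar>} \<union> {0<..r}"
    proof
      fix y assume "y \<in> {0<..x}"
      moreover have "t \<le> \<bar>f y\<bar>" if "r < y"
      proof -
        have "f y \<le> f r" using mono r that by (auto simp: monotone_on_def)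
        thus ?thesis by (simp add: t_def)
      qed
      ultimately show "y \<in> {x \<in> {0<..}. t \<le> \<bar>f x\<bar>} \<union> {0<..r}" by auto
    qed
    hence "emeasure (radial_measure m) {0<..x} \<le> emeasure (radial_measure m) ({x \<in> {0<..}. t \<le> \<bar>f x\<bar>} \<union> {0<..r})"
      using S S' by (intro emeasure_mono sets.Un) auto
    also have "\<dots> \<le> emeasure (radial_measure m) {x \<in> {0<..}. t \<le> \<bar>f x\<bar>} + emeasure (radial_measure m) {0<..r}"
      using S S' by (intro emeasure_subadditive)
    also have "\<dots> = ennreal L"
      using K m r by (simp add: emeasure_radial_Ioc distr_fun_def L_def)
    finally have "ennreal (x powr of_int m / of_int m) \<le> ennreal L" using m x by (simp add: emeasure_radial_Ioc)
    moreover have "0 \<le> L" using K m by (simp add: L_def)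
    ultimately show ?thesis by simp
  qed
  note * = this
  \<comment> \<open>As x is at least 1, its power of exponent m is at least x, which is more than m L.\<close>
  define x where "x = max 1 (of_int m * (L + 1))"
  have "x powr 1 \<le> x powr of_int m" using m by (intro powr_mono) (auto simp: x_def)
  hence "of_int m * (L + 1) \<le> x powr of_int m" by (auto simp: x_def)
  hence "L + 1 \<le> x powr of_int m / of_int m" using m by (simp add: field_simps)
  moreover have "0 < x" by (simp add: x_def less_max_iff_disj)
  ultimately show False using *[of x] by simp
qed

text \<open>A decreasing function exceeds its value at r on all of (0,r], so Chebyshev's inequality bounds
  that value. This gives the pointwise bounds for Helly's theorem.\<close>

lemma antimono_Lp_pointwise_bound:
  assumes m: "1 \<le> m" and p: "0 < p" and f: "f \<in> Lp_space (radial_measure m) p"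
    and mono: "antimono_on {0<..} f" and r: "0 < r"
  shows "f r \<le> (of_int m * r powr (- of_int m) * (\<integral>x. \<bar>f x\<bar> powr p \<partial>radial_measure m)) powr (1 / p)"
proof (cases "0 < f r")
  case True
  have fm: "f \<in> borel_measurable (radial_measure m)" using f by (simp add: Lp_space_def)
  define I where "I = (\<integral>x. \<bar>f x\<bar> powr p \<partial>radial_measure m)"
  have I0: "0 \<le> I" by (simp add: I_def)
  have "{x \<in> {0<..}. f r \<le> \<bar>f x\<bar>} \<in> sets (radial_measure m)"
    using superlevel_set_measurable[OF fm, of "f r"] unfolding space_radial_measure .
  moreover have "{0<..r} \<subseteq> {x \<in> {0<..}. f r \<le> \<bar>f x\<bar>}"
    using mono r by (auto simp: monotone_on_def intro: order_trans[OF _ abs_ge_self])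
  ultimately have "emeasure (radial_measure m) {0<..r} \<le> distr_fun (radial_measure m) f (f r)"
    unfolding distr_fun_def by (intro emeasure_mono) auto
  hence "ennreal (f r powr p) * emeasure (radial_measure m) {0<..r}
      \<le> ennreal (f r powr p) * distr_fun (radial_measure m) f (f r)"
    by (intro mult_left_mono) auto
  also have "\<dots> \<le> ennreal I" unfolding I_def by (rule distr_fun_le_Lp[OF p f True])
  finally have "ennreal (f r powr p) * emeasure (radial_measure m) {0<..r} \<le> ennreal I" .
  hence "ennreal (f r powr p * (r powr of_int m / of_int m)) \<le> ennreal I"
    using m r by (simp add: emeasure_radial_Ioc ennreal_mult[symmetric])
  hence "f r powr p * (r powr of_int m / of_int m) \<le> I" using I0 by simp
  hence "f r powr p \<le> of_int m * r powr (- of_int m) * I"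
    using m r by (simp add: field_simps powr_minus)
  hence "(f r powr p) powr (1 / p) \<le> (of_int m * r powr (- of_int m) * I) powr (1 / p)"
    using p by (intro powr_mono2) auto
  thus ?thesis using True p by (simp add: powr_powr I_def)
next
  case False
  thus ?thesis using powr_ge_zero order_trans by (metis linorder_not_less)
qed

lemma radial_Ioc_scale:
  assumes c: "0 < c" and a: "0 \<le> a"
  shows "emeasure (radial_measure m) {c * a<..c * b} = ennreal (c powr of_int m) * emeasure (radial_measure m) {a<..b}"
proof -
  have S: "{x<..y} \<in> sets (radial_measure m)" if "0 \<le> x" for x y
    using that by (auto simp: sets_restrict_space_iff)
  have ca: "0 \<le> c * a" using c a by simp
  have "emeasure (radial_measure m) {c * a<..c * b} = (\<integral>\<^sup>+r. indicator {c * a<..c * b} r \<partial>radial_measure m)"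
    using S[OF ca] by simp
  also have "\<dots> = ennreal (c powr of_int m) * (\<integral>\<^sup>+r. indicator {c * a<..c * b} (c * r) \<partial>radial_measure m)"
    using S[OF ca] by (intro nn_integral_radial_scale c) auto
  also have "(\<lambda>r. indicator {c * a<..c * b} (c * r) :: ennreal) = indicator {a<..b}"
    using c by (auto simp: indicator_def fun_eq_iff)
  also have "(\<integral>\<^sup>+r. indicator {a<..b} r \<partial>radial_measure m) = emeasure (radial_measure m) {a<..b}"
    using S[OF a] by simp
  finally show ?thesis .
qed

text \<open>The density is bounded above and below on the annulus, for every dimension.\<close>

lemma radial_measure_annulus:
  "0 < emeasure (radial_measure m) {1<..2}" "emeasure (radial_measure m) {1<..2} < \<infinity>"
proof -
  have S: "{1<..2} \<in> sets (radial_measure m)" by (auto simp: sets_restrict_space_iff)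
  define K where "K = 2 powr \<bar>of_int (m - 1) :: real\<bar>"
  have K: "1 \<le> K" by (simp add: K_def ge_one_powr_ge_zero)
  have b: "r powr of_int (m - 1) \<le> K" "1 / K \<le> r powr of_int (m - 1)" if "1 < r" "r \<le> 2" for r :: real
  proof -
    have "r powr of_int (m - 1) \<le> r powr \<bar>of_int (m - 1)\<bar>" using that by (intro powr_mono) auto
    also have "\<dots> \<le> K" unfolding K_def using that by (intro powr_mono2) auto
    finally show "r powr of_int (m - 1) \<le> K" .
    have "r powr \<bar>of_int (m - 1)\<bar> \<le> K" unfolding K_def using that by (intro powr_mono2) auto
    hence "1 / K \<le> r powr (- \<bar>of_int (m - 1)\<bar>)" using that K by (simp add: powr_minus field_simps)
    also have "\<dots> \<le> r powr of_int (m - 1)" using that by (intro powr_mono) auto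
    finally show "1 / K \<le> r powr of_int (m - 1)" .
  qed
  have eq: "emeasure (radial_measure m) {1<..2}
      = (\<integral>\<^sup>+r. ennreal (r powr of_int (m - 1)) * (indicator {1<..2} r * indicator {0<..} r) \<partial>lborel)"
    using S nn_integral_radial_measure[of "indicator {1<..2}" m] by simp
  have "(\<integral>\<^sup>+r. ennreal (1 / K) * indicator {1<..2::real} r \<partial>lborel) \<le> emeasure (radial_measure m) {1<..2}"
    unfolding eq using b by (intro nn_integral_mono) (auto simp: indicator_def intro: ennreal_leI)
  moreover have "(\<integral>\<^sup>+r. ennreal (1 / K) * indicator {1<..2::real} r \<partial>lborel) = ennreal (1 / K)"
    by (subst nn_integral_cmult_indicator) auto
  moreover have "0 < ennreal (1 / K)" using K by simp
  ultimately show "0 < emeasure (radial_measure m) {1<..2}" by order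
  have "emeasure (radial_measure m) {1<..2} \<le> (\<integral>\<^sup>+r. ennreal K * indicator {1<..2::real} r \<partial>lborel)"
    unfolding eq using b by (intro nn_integral_mono) (auto simp: indicator_def intro: ennreal_leI)
  also have "\<dots> = ennreal K" by (subst nn_integral_cmult_indicator) auto
  also have "\<dots> < \<infinity>" by simp
  finally show "emeasure (radial_measure m) {1<..2} < \<infinity>" .
qed

text \<open>If m is nonpositive, then all intervals (0,r] have infinite measure by homogeneity, so the
  superlevel sets of a decreasing function are empty or of infinite measure. The indicator function
  of an annulus then has no nonincreasing rearrangement.\<close>

lemma dimension_ge_one:
  assumes rearr: "\<And>f. f \<in> Lp_space (radial_measure m) p \<Longrightarrow> \<exists>g. nonincr_rearrangement m f g"
  shows "1 \<le> m"
proof (rule ccontr)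
  assume "\<not> 1 \<le> m"
  hence m: "m \<le> 0" by simp
  let ?\<mu> = "emeasure (radial_measure m)"
  define f :: "real \<Rightarrow> real" where "f = indicator {1<..2}"
  have S: "{x<..y} \<in> sets (radial_measure m)" if "0 \<le> x" for x y
    using that by (auto simp: sets_restrict_space_iff)
  have "(\<integral>\<^sup>+r. ennreal (\<bar>f r\<bar> powr p) \<partial>radial_measure m) = (\<integral>\<^sup>+r. indicator {1<..2} r \<partial>radial_measure m)"
    by (intro nn_integral_cong) (auto simp: f_def indicator_def)
  hence "f \<in> Lp_space (radial_measure m) p"
    using S[of 1 2] radial_measure_annulus(2)[of m] by (simp add: Lp_space_iff_nn_integral f_def)
  from rearr[OF this] obtain g where g: "nonincr_rearrangement m f g" by blast
  have "{r \<in> {0<..}. 1 \<le> \<bar>f r\<bar>} = {1<..2}" by (auto simp: f_def indicator_def)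
  with g have level: "?\<mu> {r \<in> {0<..}. 1 \<le> g r} = ?\<mu> {1<..2}"
    by (auto simp: nonincr_rearrangement_def)
  have mono: "antimono_on {0<..} g" using g by (simp add: nonincr_rearrangement_def)
  have "?\<mu> {r \<in> {0<..}. 1 \<le> g r} \<noteq> 0" using level radial_measure_annulus(1)[of m] by auto
  hence "{r \<in> {0<..}. 1 \<le> g r} \<noteq> {}" by (metis emeasure_empty)
  then obtain r where r: "0 < r" "1 \<le> g r" by auto
  have gm: "g \<in> borel_measurable (radial_measure m)"
    using borel_measurable_antimono_on[OF mono] by (simp add: measurable_cong_sets[OF sets_radial_measure refl])
  have "{x \<in> space (radial_measure m). 1 \<le> g x} \<in> sets (radial_measure m)"
    by (rule borel_measurable_le[OF borel_measurable_const gm])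
  hence "?\<mu> {0<..r} \<le> ?\<mu> {r \<in> {0<..}. 1 \<le> g r}"
    using r mono by (intro emeasure_mono) (auto simp: monotone_on_def intro: order_trans)
  hence fin: "?\<mu> {0<..r} < \<infinity>" using level radial_measure_annulus(2)[of m] by (auto intro: le_less_trans)
  \<comment> \<open>Halving r does not decrease the measure of (0,r], although it removes an annulus.\<close>
  have "{0<..r} = {0<..r/2} \<union> {r/2<..r}" using r by auto
  hence "?\<mu> {0<..r} = ?\<mu> ({0<..r/2} \<union> {r/2<..r})" by simp
  also have "\<dots> = ?\<mu> {0<..r/2} + ?\<mu> {r/2<..r}"
    using S r by (intro plus_emeasure[symmetric]) auto
  finally have sum: "?\<mu> {0<..r} = ?\<mu> {0<..r/2} + ?\<mu> {r/2<..r}" .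
  have "?\<mu> {1/2 * 0<..1/2 * r} = ennreal ((1/2) powr of_int m) * ?\<mu> {0<..r}"
    by (rule radial_Ioc_scale) auto
  moreover have "1 \<le> (1/2) powr (of_int m :: real)" using m powr_mono'[of "of_int m" 0 "1/2::real"] by auto
  ultimately have ge: "?\<mu> {0<..r} \<le> ?\<mu> {0<..r/2}"
    using mult_right_mono[of 1 "ennreal ((1/2) powr of_int m)" "?\<mu> {0<..r}"] by simp
  have "?\<mu> {r/2 * 1<..r/2 * 2} = ennreal ((r/2) powr of_int m) * ?\<mu> {1<..2}"
    using r by (intro radial_Ioc_scale) auto
  hence pos: "0 < ?\<mu> {r/2<..r}" using r radial_measure_annulus(1)[of m] by (simp add: ennreal_zero_less_mult_iff)
  have "?\<mu> {0<..r} < ?\<mu> {0<..r} + ?\<mu> {r/2<..r}"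
    using fin pos by (simp add: ennreal_add_left_cancel_less[of _ 0, simplified] less_top)
  also have "\<dots> \<le> ?\<mu> {0<..r}" using ge sum by (simp add: add_right_mono)
  finally show False by simp
qed

section \<open>Pointwise bounds from mass on both sides\<close>

text \<open>Reduces monotone unions over arbitrary sets of reals to countable ones. The supremum of Z may
  or may not be attained; an attained maximum is added by hand.\<close>

lemma countable_cofinal_subset:
  fixes Z :: "real set"
  obtains C where "countable C" "C \<subseteq> Z" "\<And>z. z \<in> Z \<Longrightarrow> \<exists>c\<in>C. z \<le> c"
proof -
  define R where "R = {r \<in> \<rat>. \<exists>z\<in>Z. r < z}"
  have "\<forall>r\<in>R. \<exists>z. z \<in> Z \<and> r < z" by (auto simp: R_def)
  then obtain f where f: "\<And>r. r \<in> R \<Longrightarrow> f r \<in> Z" "\<And>r. r \<in> R \<Longrightarrow> r < f r" by metis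
  define Y where "Y = {z \<in> Z. \<forall>z'\<in>Z. z' \<le> z}"
  have sub: "Y \<subseteq> {y}" if "y \<in> Y" for y using that by (auto simp: Y_def intro: antisym)
  have "countable Y"
  proof (cases "Y = {}")
    case False
    then obtain y where "y \<in> Y" by blast
    from countable_subset[OF sub[OF this]] show ?thesis by simp
  qed simp
  moreover have "countable R" by (rule countable_subset[OF _ countable_rat]) (auto simp: R_def)
  ultimately have "countable (f ` R \<union> Y)" by simp
  moreover have "f ` R \<union> Y \<subseteq> Z" using f by (auto simp: Y_def)
  moreover have "\<exists>c\<in>f ` R \<union> Y. z \<le> c" if z: "z \<in> Z" for z
  proof (cases "z \<in> Y")
    case False
    then obtain z' where z': "z' \<in> Z" "z < z'" using z by (auto simp: Y_def not_le)
    obtain r where r: "r \<in> \<rat>" "z < r" "r < z'" using Rats_dense_in_real[OF z'(2)] by blast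
    hence "r \<in> R" using z' by (auto simp: R_def)
    thus ?thesis using f(2)[of r] r by (intro bexI[of _ "f r"]) auto
  qed auto
  ultimately show ?thesis using that by blast
qed

text \<open>The points excluded here are covered by null intervals starting at 0 and null half-lines, of
  which countably many suffice. At the remaining points a decreasing function is bounded in terms of
  its norm, since there is mass on both sides.\<close>

lemma AE_positive_tail_measures:
  assumes sets: "sets \<sigma> = sets (restrict_space borel {0::real..})" and null: "emeasure \<sigma> {0} = 0"
  shows "AE x in \<sigma>. 0 < x \<and> 0 < emeasure \<sigma> {0<..x} \<and> 0 < emeasure \<sigma> {x..}"
proof -
  have sp: "space \<sigma> = {0..}" using sets_eq_imp_space_eq[OF sets] by (simp add: space_restrict_space)
  have S: "A \<in> sets \<sigma>" if "A \<in> sets borel" "A \<subseteq> {0..}" for A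
    using that by (auto simp: sets sets_restrict_space_iff)
  define Z1 where "Z1 = {x. 0 < x \<and> emeasure \<sigma> {0<..x} = 0}"
  define Z2 where "Z2 = {x. 0 < x \<and> emeasure \<sigma> {x..} = 0}"
  obtain C1 where C1: "countable C1" "C1 \<subseteq> Z1" "\<And>z. z \<in> Z1 \<Longrightarrow> \<exists>c\<in>C1. z \<le> c"
    using countable_cofinal_subset by blast
  obtain C2 where C2: "countable C2" "C2 \<subseteq> uminus ` Z2" "\<And>z. z \<in> uminus ` Z2 \<Longrightarrow> \<exists>c\<in>C2. z \<le> c"
    using countable_cofinal_subset by blast
  define N where "N = {0} \<union> (\<Union>x\<in>C1. {0<..x}) \<union> (\<Union>x\<in>C2. {-x..})"
  have "N \<in> null_sets \<sigma>" unfolding N_def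
  proof (intro null_sets.Un null_sets_UN' C1 C2)
    show "{0} \<in> null_sets \<sigma>" using null S by (auto simp: null_sets_def)
    show "{0<..x} \<in> null_sets \<sigma>" if "x \<in> C1" for x
      using C1(2) that S[of "{0<..x}"] by (auto simp: subset_eq null_sets_def Z1_def)
    show "{-x..} \<in> null_sets \<sigma>" if "x \<in> C2" for x
      using C2(2) that S[of "{-x..}"] by (auto simp: subset_eq null_sets_def Z2_def)
  qed
  moreover have "{x \<in> space \<sigma>. \<not> (0 < x \<and> 0 < emeasure \<sigma> {0<..x} \<and> 0 < emeasure \<sigma> {x..})} \<subseteq> N"
  proof
    fix x assume x: "x \<in> {x \<in> space \<sigma>. \<not> (0 < x \<and> 0 < emeasure \<sigma> {0<..x} \<and> 0 < emeasure \<sigma> {x..})}"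
    hence "x = 0 \<or> x \<in> Z1 \<or> x \<in> Z2" by (auto simp: sp Z1_def Z2_def not_gr_zero)
    thus "x \<in> N"
    proof (elim disjE)
      assume "x \<in> Z1"
      moreover from C1(3)[OF this] obtain c where "c \<in> C1" "x \<le> c" by blast
      ultimately show ?thesis by (auto simp: N_def Z1_def)
    next
      assume "x \<in> Z2"
      hence "- x \<in> uminus ` Z2" by blast
      from C2(3)[OF this] obtain c where "c \<in> C2" "- x \<le> c" by blast
      hence "x \<in> {- c..}" by simp
      thus ?thesis unfolding N_def using \<open>c \<in> C2\<close> by blast
    qed (auto simp: N_def)
  qed
  ultimately show ?thesis by (intro AE_I') 
qed

text \<open>Chebyshev's inequality solved for the level. The minimum with 1 keeps the denominator finite
  for sets of infinite measure.\<close>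

lemma Lp_level_bound:
  assumes q: "0 < q" and g: "g \<in> Lp_space N q" and S: "S \<in> sets N" "0 < emeasure N S"
    and t: "0 \<le> t" and ae: "AE y in N. y \<in> S \<longrightarrow> t \<le> \<bar>g y\<bar>"
  shows "t \<le> ((\<integral>x. \<bar>g x\<bar> powr q \<partial>N) / enn2real (min 1 (emeasure N S))) powr (1 / q)"
proof -
  define I where "I = (\<integral>x. \<bar>g x\<bar> powr q \<partial>N)"
  define e where "e = enn2real (min 1 (emeasure N S))"
  have fin: "min 1 (emeasure N S) < top" by (rule le_less_trans[of _ 1]) auto
  have e: "ennreal e = min 1 (emeasure N S)" unfolding e_def by (rule ennreal_enn2real[OF fin])
  have e0: "0 < e" unfolding e_def using S(2) fin by (auto simp: enn2real_positive_iff)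
  have "ennreal (t powr q * e) = ennreal (t powr q) * min 1 (emeasure N S)"
    using e0 by (simp add: ennreal_mult e)
  also have "\<dots> \<le> ennreal (t powr q) * emeasure N S" by (intro mult_left_mono) auto
  also have "\<dots> = (\<integral>\<^sup>+x. ennreal (t powr q) * indicator S x \<partial>N)"
    using S by (intro nn_integral_cmult_indicator[symmetric])
  also have "\<dots> \<le> (\<integral>\<^sup>+x. ennreal (\<bar>g x\<bar> powr q) \<partial>N)"
    using ae t q by (intro nn_integral_mono_AE)
      (auto elim!: eventually_mono simp: indicator_def intro!: ennreal_leI powr_mono2)
  also have "\<dots> = ennreal I" unfolding I_def by (rule nn_integral_eq_integral_Lp[OF g])
  finally have "t powr q * e \<le> I" by (simp add: I_def)
  hence "t powr q \<le> I / e" using e0 by (simp add: field_simps)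
  hence "(t powr q) powr (1 / q) \<le> (I / e) powr (1 / q)" using q by (intro powr_mono2) auto
  thus ?thesis using q t by (simp add: powr_powr I_def e_def)
qed

section \<open>Extremizing sequences of decreasing functions\<close>

text \<open>Strict superadditivity of powers above 1: splitting the mass into two nontrivial parts loses
  a definite amount. This is where extremizing sequences are prevented from splitting.\<close>

lemma powr_sum_less_one:
  fixes a e :: real
  assumes "0 < a" "a < 1" "1 < e"
  shows "a powr e + (1 - a) powr e < 1"
proof -
  have "a powr e < a powr 1" "(1 - a) powr e < (1 - a) powr 1" using assms by (auto intro: powr_less_mono' simp del: powr_one powr_one')
  thus ?thesis using assms by simp
qed

text \<open>The hypotheses on the operator, apart from the rearrangement inequality. That the dimension is
  positive follows from the existence of rearrangements, by \<open>dimension_ge_one\<close>.\<close>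

locale dilation_invariant_operator =
  fixes m :: int and p q \<delta> :: real and \<sigma> :: "real measure"
    and T :: "(real \<Rightarrow> real) \<Rightarrow> real \<Rightarrow> real"
  assumes dim: "1 \<le> m"
    and sets_\<sigma>: "sets \<sigma> = sets (restrict_space borel {0..})" and null_0: "emeasure \<sigma> {0} = 0"
    and p: "1 < p" and pq: "p < q" and \<delta>: "0 < \<delta>" "p + \<delta> < q - \<delta>"
    and Lp_op: "bounded_linear_op (Lp_space (radial_measure m) p) (Lp_norm (radial_measure m) p)
           (Lp_space \<sigma> q) (Lp_norm \<sigma> q) \<sigma> T"
    and lorentz_op: "bounded_linear_op
           (lorentz_space (radial_measure m) p (p + \<delta>)) (lorentz_norm (radial_measure m) p (p + \<delta>))
           (lorentz_space \<sigma> q (q - \<delta>)) (lorentz_norm \<sigma> q (q - \<delta>)) \<sigma> T"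
    and image_antimono: "\<And>f. f \<in> Lp_space (radial_measure m) p \<Longrightarrow> (\<And>r. 0 < r \<Longrightarrow> 0 \<le> f r) \<Longrightarrow>
           antimono_on {0<..} f \<Longrightarrow> \<exists>h. antimono_on {0<..} h \<and> (AE x in \<sigma>. T f x = h x)"
    and dilation_invariant: "\<And>c f. 0 < c \<Longrightarrow> f \<in> Lp_space (radial_measure m) p \<Longrightarrow>
           Lp_norm \<sigma> q (T (dilation m p c f)) = Lp_norm \<sigma> q (T f)"

begin

abbreviation "\<mu> \<equiv> radial_measure m"

abbreviation "A \<equiv> optimal_const m p \<sigma> q T"

lemma q: "1 < q" using p pq by simp

lemma T_lincomb:
  "f \<in> Lp_space \<mu> p \<Longrightarrow> g \<in> Lp_space \<mu> p \<Longrightarrow>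
    AE x in \<sigma>. T (\<lambda>r. a * f r + b * g r) x = a * T f x + b * T g x"
  using Lp_op unfolding bounded_linear_op_def by blast

lemma T_Lp: "f \<in> Lp_space \<mu> p \<Longrightarrow> T f \<in> Lp_space \<sigma> q"
  using Lp_op unfolding bounded_linear_op_def by blast

lemma Lp_norm_nonneg [simp]: "0 \<le> Lp_norm N r f"
  by (simp add: Lp_norm_def)

definition admissible_consts :: "real set" where
  "admissible_consts = {B. 0 \<le> B \<and> (\<forall>f\<in>Lp_space \<mu> p. Lp_norm \<sigma> q (T f) \<le> B * Lp_norm \<mu> p f)}"

lemma A_eq: "A = Inf admissible_consts" by (simp add: optimal_const_def admissible_consts_def)

lemma admissible_consts_nonempty: "\<exists>B. B \<in> admissible_consts"
proof -
  obtain C where C: "\<And>f. f \<in> Lp_space \<mu> p \<Longrightarrow> Lp_norm \<sigma> q (T f) \<le> C * Lp_norm \<mu> p f"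
    using Lp_op unfolding bounded_linear_op_def by blast
  have "Lp_norm \<sigma> q (T f) \<le> max C 0 * Lp_norm \<mu> p f" if "f \<in> Lp_space \<mu> p" for f
    using C[OF that] by (rule order_trans) (intro mult_right_mono, auto)
  thus ?thesis by (intro exI[of _ "max C 0"]) (auto simp: admissible_consts_def)
qed

lemma A_nonneg: "0 \<le> A"
  unfolding A_eq using admissible_consts_nonempty by (intro cInf_greatest) (auto simp: admissible_consts_def)

lemma A_le: "B \<in> admissible_consts \<Longrightarrow> A \<le> B"
  unfolding A_eq by (intro cInf_lower bdd_belowI[of _ 0]) (auto simp: admissible_consts_def)

text \<open>The infimum defining the optimal constant is attained.\<close>

lemma T_norm_le:
  assumes f: "f \<in> Lp_space \<mu> p"
  shows "Lp_norm \<sigma> q (T f) \<le> A * Lp_norm \<mu> p f"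
proof (cases "Lp_norm \<mu> p f = 0")
  case True
  obtain B where "B \<in> admissible_consts" using admissible_consts_nonempty by blast
  thus ?thesis using f True by (auto simp: admissible_consts_def)
next
  case False
  hence pos: "0 < Lp_norm \<mu> p f" by (simp add: order_less_le)
  have "Lp_norm \<sigma> q (T f) / Lp_norm \<mu> p f \<le> A"
    unfolding A_eq using admissible_consts_nonempty f pos
    by (intro cInf_greatest) (auto simp: admissible_consts_def pos_divide_le_eq)
  thus ?thesis using pos by (simp add: pos_divide_le_eq)
qed

lemma T_integral_le:
  assumes f: "f \<in> Lp_space \<mu> p"
  shows "(\<integral>x. \<bar>T f x\<bar> powr q \<partial>\<sigma>) \<le> A powr q * (\<integral>x. \<bar>f x\<bar> powr p \<partial>\<mu>) powr (q / p)"
  using p q A_nonneg T_norm_le[OF f] by (intro Lp_norm_le_imp_integral_le) auto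

text \<open>A pointwise bound by a multiple of the critical power confines each superlevel set to an
  interval (0,\<rho>], and so bounds the weak norm.\<close>

lemma weak_norm_le:
  assumes \<kappa>: "0 < \<kappa>" and f: "f \<in> Lp_space \<mu> p" "\<And>r. 0 < r \<Longrightarrow> 0 \<le> f r"
    and small: "\<And>r. 0 < r \<Longrightarrow> r powr (of_int m / p) * f r \<le> \<kappa>" and t: "0 < t"
  shows "enn2real (distr_fun \<mu> f t) powr (1 / p) * t \<le> \<kappa>"
proof -
  define \<rho> where "\<rho> = (\<kappa> / t) powr (p / of_int m)"
  have \<rho>: "0 < \<rho>" using \<kappa> t by (simp add: \<rho>_def)
  have "{r \<in> {0<..}. t \<le> \<bar>f r\<bar>} \<subseteq> {0<..\<rho>}"
  proof safe
    fix r :: real assume r: "0 < r" "t \<le> \<bar>f r\<bar>"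
    have "r powr (of_int m / p) * t \<le> r powr (of_int m / p) * f r"
      using r f(2)[of r] by (intro mult_left_mono) auto
    also have "\<dots> \<le> \<kappa>" by (rule small[OF r(1)])
    finally have "r powr (of_int m / p) \<le> \<kappa> / t" using t by (simp add: field_simps)
    hence "(r powr (of_int m / p)) powr (p / of_int m) \<le> \<rho>"
      unfolding \<rho>_def using p dim by (intro powr_mono2) auto
    thus "r \<in> {0<..\<rho>}" using r p dim by (simp add: powr_powr)
  qed
  hence "distr_fun \<mu> f t \<le> emeasure \<mu> {0<..\<rho>}" unfolding distr_fun_def space_radial_measure
    by (intro emeasure_mono) (auto simp: sets_restrict_space_iff)
  also have "\<dots> = ennreal (\<rho> powr of_int m / of_int m)" by (rule emeasure_radial_Ioc[OF dim \<rho>])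
  finally have "enn2real (distr_fun \<mu> f t) \<le> \<rho> powr of_int m / of_int m"
    using dim by (simp add: enn2real_leI)
  also have "\<dots> \<le> \<rho> powr of_int m" using dim divide_left_mono[of 1 "of_int m" "\<rho> powr of_int m"] by simp
  also have "\<dots> = (\<kappa> / t) powr p" using dim by (simp add: \<rho>_def powr_powr)
  finally have "enn2real (distr_fun \<mu> f t) powr (1 / p) \<le> ((\<kappa> / t) powr p) powr (1 / p)"
    using p by (intro powr_mono2) auto
  also have "\<dots> = \<kappa> / t" using \<kappa> t p by (simp add: powr_powr)
  finally show ?thesis using t by (simp add: field_simps)
qed

text \<open>The use of the Lorentz bound on the operator: the image norm is controlled by the Lorentz norm
  on the target side, hence by the one in the domain, hence by a positive power of the weak norm.\<close>

lemma T_small_of_weakly_small: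
  obtains C where "0 \<le> C"
    "\<And>\<kappa> f. 0 < \<kappa> \<Longrightarrow> f \<in> Lp_space \<mu> p \<Longrightarrow> (\<And>r. 0 < r \<Longrightarrow> 0 \<le> f r) \<Longrightarrow> Lp_norm \<mu> p f = 1 \<Longrightarrow>
      (\<And>r. 0 < r \<Longrightarrow> r powr (of_int m / p) * f r \<le> \<kappa>) \<Longrightarrow>
      Lp_norm \<sigma> q (T f) powr q \<le> C * \<kappa> powr (\<delta> * q / (p + \<delta>))"
proof -
  obtain C0 where C0: "\<And>f. f \<in> lorentz_space \<mu> p (p + \<delta>) \<Longrightarrow> T f \<in> lorentz_space \<sigma> q (q - \<delta>) \<and>
      lorentz_norm \<sigma> q (q - \<delta>) (T f) \<le> C0 * lorentz_norm \<mu> p (p + \<delta>) f"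
    using lorentz_op unfolding bounded_linear_op_def by blast
  define C1 where "C1 = max C0 0"
  define K where "K = q * (q - \<delta>) powr ((q - (q - \<delta>)) / (q - \<delta>))"
  have K: "0 \<le> K" using q by (simp add: K_def)
  define C where "C = K * (C1 powr q * (1 / p) powr (q / (p + \<delta>)))"
  have "Lp_norm \<sigma> q (T f) powr q \<le> C * \<kappa> powr (\<delta> * q / (p + \<delta>))"
    if \<kappa>: "0 < \<kappa>" and f: "f \<in> Lp_space \<mu> p" "\<And>r. 0 < r \<Longrightarrow> 0 \<le> f r" "Lp_norm \<mu> p f = 1"
      and small: "\<And>r. 0 < r \<Longrightarrow> r powr (of_int m / p) * f r \<le> \<kappa>" for \<kappa> f
  proof -
    have I1: "(\<integral>x. \<bar>f x\<bar> powr p \<partial>\<mu>) = 1" using Lp_norm_powr[of p \<mu> f] p f(3) by simp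
    note weak = weak_norm_le[OF \<kappa> f(1,2) small]
    have L: "f \<in> lorentz_space \<mu> p (p + \<delta>)"
      using p \<delta> \<kappa> f(1) weak by (intro lorentz_norm_le_weak_norm[where K = \<kappa>]) auto
    have N: "lorentz_norm \<mu> p (p + \<delta>) f \<le> (\<kappa> powr \<delta> / p) powr (1 / (p + \<delta>))"
      using lorentz_norm_le_weak_norm(2)[of p \<delta> \<kappa> f \<mu>] p \<delta> \<kappa> f(1) weak I1 by simp
    have n0: "0 \<le> lorentz_norm \<mu> p (p + \<delta>) f" by (simp add: lorentz_norm_def)
    have "lorentz_norm \<sigma> q (q - \<delta>) (T f) \<le> C0 * lorentz_norm \<mu> p (p + \<delta>) f" using C0[OF L] by simp
    also have "\<dots> \<le> C1 * lorentz_norm \<mu> p (p + \<delta>) f" using n0 by (intro mult_right_mono) (auto simp: C1_def)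
    also have "\<dots> \<le> C1 * (\<kappa> powr \<delta> / p) powr (1 / (p + \<delta>))" using N by (intro mult_left_mono) (auto simp: C1_def)
    finally have N': "lorentz_norm \<sigma> q (q - \<delta>) (T f) \<le> C1 * (\<kappa> powr \<delta> / p) powr (1 / (p + \<delta>))" .
    have "Lp_norm \<sigma> q (T f) powr q = (\<integral>x. \<bar>T f x\<bar> powr q \<partial>\<sigma>)" using q by (simp add: Lp_norm_powr)
    also have "\<dots> \<le> K * lorentz_norm \<sigma> q (q - \<delta>) (T f) powr q"
      unfolding K_def using \<delta> p T_Lp[OF f(1)] C0[OF L] by (intro Lp_le_lorentz_norm) auto
    also have "\<dots> \<le> K * (C1 * (\<kappa> powr \<delta> / p) powr (1 / (p + \<delta>))) powr q"
      using N' K q by (intro mult_left_mono powr_mono2) (auto simp: lorentz_norm_def)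
    also have "(C1 * (\<kappa> powr \<delta> / p) powr (1 / (p + \<delta>))) powr q = C1 powr q * (\<kappa> powr \<delta> * (1 / p)) powr (q / (p + \<delta>))"
      by (simp add: powr_mult powr_powr C1_def)
    also have "(\<kappa> powr \<delta> * (1 / p)) powr (q / (p + \<delta>)) = \<kappa> powr (\<delta> * q / (p + \<delta>)) * (1 / p) powr (q / (p + \<delta>))"
      using p \<kappa> by (subst powr_mult) (auto simp: powr_powr)
    finally show ?thesis by (simp add: C_def mult_ac)
  qed
  moreover have "0 \<le> C" using K by (simp add: C_def)
  ultimately show ?thesis using that by blast
qed

text \<open>Consequently nearly extremal decreasing functions cannot vanish in the limit: each one has a
  sizeable value at some scale r, which a dilation moves to 1.\<close>

lemma extremizing_not_weakly_small:
  assumes A: "0 < A"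
  obtains \<kappa> where "0 < \<kappa>"
    "\<And>f. f \<in> Lp_space \<mu> p \<Longrightarrow> (\<And>r. 0 < r \<Longrightarrow> 0 \<le> f r) \<Longrightarrow> Lp_norm \<mu> p f = 1 \<Longrightarrow>
      A / 2 < Lp_norm \<sigma> q (T f) \<Longrightarrow> \<exists>r>0. \<kappa> < r powr (of_int m / p) * f r"
proof -
  obtain C where C: "0 \<le> C"
    "\<And>\<kappa> f. 0 < \<kappa> \<Longrightarrow> f \<in> Lp_space \<mu> p \<Longrightarrow> (\<And>r. 0 < r \<Longrightarrow> 0 \<le> f r) \<Longrightarrow> Lp_norm \<mu> p f = 1 \<Longrightarrow>
      (\<And>r. 0 < r \<Longrightarrow> r powr (of_int m / p) * f r \<le> \<kappa>) \<Longrightarrow>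
      Lp_norm \<sigma> q (T f) powr q \<le> C * \<kappa> powr (\<delta> * q / (p + \<delta>))"
    using T_small_of_weakly_small by blast
  have "((\<lambda>\<kappa>. C * \<kappa> powr (\<delta> * q / (p + \<delta>))) \<longlongrightarrow> C * 0 powr (\<delta> * q / (p + \<delta>))) (at_right 0)"
    using p q \<delta> by (intro tendsto_mult tendsto_const tendsto_powr2 tendsto_ident_at)
      (auto simp: eventually_at_filter)
  moreover have "C * 0 powr (\<delta> * q / (p + \<delta>)) < (A / 2) powr q" using A by simp
  ultimately have "eventually (\<lambda>\<kappa>. C * \<kappa> powr (\<delta> * q / (p + \<delta>)) < (A / 2) powr q) (at_right 0)"
    by (rule order_tendstoD)
  moreover have "eventually (\<lambda>\<kappa>::real. 0 < \<kappa>) (at_right 0)" by (simp add: eventually_at_filter)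
  ultimately have "eventually (\<lambda>\<kappa>. 0 < \<kappa> \<and> C * \<kappa> powr (\<delta> * q / (p + \<delta>)) < (A / 2) powr q) (at_right 0)"
    by (intro eventually_conj)
  then obtain \<kappa> where \<kappa>: "0 < \<kappa>" "C * \<kappa> powr (\<delta> * q / (p + \<delta>)) < (A / 2) powr q"
    using eventually_happens'[OF trivial_limit_at_right_real] by blast
  have "\<exists>r>0. \<kappa> < r powr (of_int m / p) * f r"
    if f: "f \<in> Lp_space \<mu> p" "\<And>r. 0 < r \<Longrightarrow> 0 \<le> f r" "Lp_norm \<mu> p f = 1" "A / 2 < Lp_norm \<sigma> q (T f)" for f
  proof (rule ccontr)
    assume "\<not> ?thesis"
    hence "r powr (of_int m / p) * f r \<le> \<kappa>" if "0 < r" for r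
      using that by (meson linorder_not_less)
    from C(2)[OF \<kappa>(1) f(1,2,3) this] have "Lp_norm \<sigma> q (T f) powr q \<le> C * \<kappa> powr (\<delta> * q / (p + \<delta>))" .
    moreover have "(A / 2) powr q \<le> Lp_norm \<sigma> q (T f) powr q" using f(4) A q by (intro powr_mono2) auto
    ultimately show False using \<kappa>(2) by linarith
  qed
  thus ?thesis using that[OF \<kappa>(1)] by blast
qed

text \<open>Helly's theorem for the images, which are decreasing but possibly of either sign. A large
  positive value at x forces large values on (0,x], a very negative one forces them on the half-line
  from x on; both are limited by the norm.\<close>

lemma T_antimono_sequence_AE_convergent_subsequence:
  assumes G: "\<And>n. G n \<in> Lp_space \<mu> p" "\<And>n r. 0 < r \<Longrightarrow> 0 \<le> G n r" "\<And>n. antimono_on {0<..} (G n)"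
    and bd: "\<And>n. (\<integral>x. \<bar>T (G n) x\<bar> powr q \<partial>\<sigma>) \<le> B"
  obtains k :: "nat \<Rightarrow> nat" where "strict_mono k" "AE x in \<sigma>. convergent (\<lambda>n. T (G (k n)) x)"
proof -
  have "\<exists>h. antimono_on {0<..} h \<and> (AE x in \<sigma>. T (G n) x = h x)" for n
    using G by (intro image_antimono) auto
  then obtain h where h: "\<And>n. antimono_on {0<..} (h n)" "\<And>n. AE x in \<sigma>. T (G n) x = h n x" by metis
  \<comment> \<open>An interval of full measure on which the decreasing representatives are bounded pointwise.\<close>
  define E where "E = {x. 0 < x \<and> 0 < emeasure \<sigma> {0<..x} \<and> 0 < emeasure \<sigma> {x..}}"
  have S: "S \<in> sets \<sigma>" if "S \<in> sets borel" "S \<subseteq> {0..}" for S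
    using that by (auto simp: sets_\<sigma> sets_restrict_space_iff)
  have "is_interval E" unfolding is_interval_1
  proof (intro ballI allI impI)
    fix a b x assume ab: "a \<in> E" "b \<in> E" "a \<le> x \<and> x \<le> b"
    hence "0 < x" by (auto simp: E_def)
    have "emeasure \<sigma> {0<..a} \<le> emeasure \<sigma> {0<..x}"
      using ab S[of "{0<..x}"] by (intro emeasure_mono) (auto simp: subset_eq)
    moreover have "emeasure \<sigma> {b..} \<le> emeasure \<sigma> {x..}"
      using ab \<open>0 < x\<close> S[of "{x..}"] by (intro emeasure_mono) (auto simp: subset_eq)
    ultimately show "x \<in> E" using ab \<open>0 < x\<close> by (auto simp: E_def intro: less_le_trans)
  qed
  define D where "D S = (B / enn2real (min 1 (emeasure \<sigma> S))) powr (1 / q)" for S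
  have D0: "0 \<le> D S" for S by (simp add: D_def)
  have level: "t \<le> D S" if "0 \<le> t" "S \<in> sets \<sigma>" "0 < emeasure \<sigma> S" "AE y in \<sigma>. y \<in> S \<longrightarrow> t \<le> \<bar>T (G n) y\<bar>" for t S n
  proof -
    have "t \<le> ((\<integral>x. \<bar>T (G n) x\<bar> powr q \<partial>\<sigma>) / enn2real (min 1 (emeasure \<sigma> S))) powr (1 / q)"
      using that q T_Lp[OF G(1)] by (intro Lp_level_bound) auto
    also have "\<dots> \<le> D S"
      unfolding D_def using bd[of n] q by (intro powr_mono2 divide_right_mono) auto
    finally show ?thesis .
  qed
  have bound: "\<bar>h n x\<bar> \<le> D {0<..x} + D {x..}" if x: "x \<in> E" for n x
  proof (cases "0 \<le> h n x")
    case True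
    have "AE y in \<sigma>. y \<in> {0<..x} \<longrightarrow> h n x \<le> \<bar>T (G n) y\<bar>" using h(2)[of n]
    proof eventually_elim
      case (elim y)
      show ?case
      proof
        assume "y \<in> {0<..x}"
        hence "h n x \<le> h n y" using h(1)[of n] x by (auto simp: monotone_on_def E_def)
        thus "h n x \<le> \<bar>T (G n) y\<bar>" using elim by simp
      qed
    qed
    hence "h n x \<le> D {0<..x}" using x True S[of "{0<..x}"] by (intro level) (auto simp: E_def subset_eq)
    thus ?thesis using True D0[of "{x..}"] by simp
  next
    case False
    have "AE y in \<sigma>. y \<in> {x..} \<longrightarrow> - h n x \<le> \<bar>T (G n) y\<bar>" using h(2)[of n]
    proof eventually_elim
      case (elim y)
      show ?case
      proof
        assume "y \<in> {x..}"
        hence "h n y \<le> h n x" using h(1)[of n] x by (auto simp: monotone_on_def E_def)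
        thus "- h n x \<le> \<bar>T (G n) y\<bar>" using elim by simp
      qed
    qed
    hence "- h n x \<le> D {x..}" using x False S[of "{x..}"] by (intro level) (auto simp: E_def subset_eq)
    thus ?thesis using False D0[of "{0<..x}"] by simp
  qed
  have anti: "antimono_on E (h n)" for n using h(1)[of n] by (auto simp: monotone_on_def E_def)
  obtain k :: "nat \<Rightarrow> nat"
    where k: "strict_mono k" "\<And>x. x \<in> E \<Longrightarrow> convergent (\<lambda>n. h (k n) x)"
  proof (rule helly_selection_antimono[of E h "\<lambda>x. D {0<..x} + D {x..}"])
  qed (use \<open>is_interval E\<close> anti bound in auto)
  have "AE x in \<sigma>. \<forall>n. T (G (k n)) x = h (k n) x" unfolding AE_all_countable using h(2) by blast
  with AE_positive_tail_measures[OF sets_\<sigma> null_0] have "AE x in \<sigma>. convergent (\<lambda>n. T (G (k n)) x)"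
  proof eventually_elim
    case (elim x)
    hence "x \<in> E" by (simp add: E_def)
    thus ?case using k(2) elim(2) by simp
  qed
  with k(1) show ?thesis using that by blast
qed

text \<open>After dilation all but finitely many functions exceed \<kappa> at 1, so that the pointwise limit g
  provided by Helly's theorem is nonzero. With a the p-th power of the norm of g, the Brezis-Lieb lemma
  in the domain and in the target yields 1 \<le> a^(q/p) + (1 - a)^(q/p), which forces a = 1: no mass
  is left for the remainder, so the convergence is strong, and equality holds throughout.\<close>

lemma extremizing_antimono_sequence_compact:
  assumes A: "0 < A"
    and F: "\<And>n. F n \<in> Lp_space \<mu> p" "\<And>n. Lp_norm \<mu> p (F n) = 1" "\<And>n. antimono_on {0<..} (F n)"
    and lim: "(\<lambda>n. Lp_norm \<sigma> q (T (F n))) \<longlonglongrightarrow> A"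
  obtains c k g where "\<And>n. 0 < c n" "strict_mono (k :: nat \<Rightarrow> nat)" "g \<in> Lp_space \<mu> p"
    "antimono_on {0<..} g" "Lp_norm \<mu> p g = 1" "Lp_norm \<sigma> q (T g) = A"
    "(\<lambda>n. Lp_norm \<mu> p (\<lambda>r. dilation m p (c (k n)) (F (k n)) r - g r)) \<longlonglongrightarrow> 0"
proof -
  have F0: "0 \<le> F n r" if "0 < r" for n r
    using antimono_Lp_nonneg[OF dim _ F(1,3) that] p by simp
  obtain \<kappa> where \<kappa>: "0 < \<kappa>" "\<And>f. f \<in> Lp_space \<mu> p \<Longrightarrow> (\<And>r. 0 < r \<Longrightarrow> 0 \<le> f r) \<Longrightarrow> Lp_norm \<mu> p f = 1 \<Longrightarrow>
      A / 2 < Lp_norm \<sigma> q (T f) \<Longrightarrow> \<exists>r>0. \<kappa> < r powr (of_int m / p) * f r"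
    using extremizing_not_weakly_small[OF A] by blast
  have "eventually (\<lambda>n. A / 2 < Lp_norm \<sigma> q (T (F n))) sequentially"
    using A by (intro order_tendstoD(1)[OF lim]) auto
  then obtain N where N: "\<And>n. N \<le> n \<Longrightarrow> A / 2 < Lp_norm \<sigma> q (T (F n))" by (auto simp: eventually_sequentially)
  \<comment> \<open>For the finitely many n below N any scale will do.\<close>
  have "\<exists>r>0. N \<le> n \<longrightarrow> \<kappa> < r powr (of_int m / p) * F n r" for n
  proof (cases "N \<le> n")
    case True
    from \<kappa>(2)[OF F(1) F0 F(2) N[OF True]] show ?thesis by blast
  qed (auto intro: exI[of _ 1])
  then obtain c where c: "\<And>n. 0 < c n" "\<And>n. N \<le> n \<Longrightarrow> \<kappa> < c n powr (of_int m / p) * F n (c n)" by metis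
  define G where "G n = dilation m p (c n) (F n)" for n
  have G: "G n \<in> Lp_space \<mu> p" "Lp_norm \<mu> p (G n) = 1" "Lp_norm \<sigma> q (T (G n)) = Lp_norm \<sigma> q (T (F n))" for n
    using dilation_Lp[OF _ c(1) F(1), of n] p F(2)[of n] dilation_invariant[OF c(1) F(1), of n]
    by (auto simp: G_def)
  have G_mono: "antimono_on {0<..} (G n)" for n
    using F(3)[of n] c(1)[of n] unfolding monotone_on_def G_def dilation_def
    by (auto intro!: mult_left_mono)
  have G0: "0 \<le> G n r" if "0 < r" for n r
    using F0[of "c n * r" n] c(1)[of n] that by (simp add: G_def dilation_def)
  have G1: "\<kappa> < G n 1" if "N \<le> n" for n using c(2)[OF that] by (simp add: G_def dilation_def)
  have G_int: "(\<integral>x. \<bar>G n x\<bar> powr p \<partial>\<mu>) = 1" for n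
    using Lp_norm_powr[of p \<mu> "G n"] p G(2)[of n] by simp
  have TG_int: "(\<integral>x. \<bar>T (G n) x\<bar> powr q \<partial>\<sigma>) = Lp_norm \<sigma> q (T (F n)) powr q" for n
    using Lp_norm_powr[of q \<sigma> "T (G n)"] q G(3)[of n] by simp
  have TG_bd: "(\<integral>x. \<bar>T (G n) x\<bar> powr q \<partial>\<sigma>) \<le> A powr q" for n
    using T_integral_le[OF G(1)[of n]] by (simp add: G_int)
  obtain k1 :: "nat \<Rightarrow> nat" where k1: "strict_mono k1" "\<And>r. r \<in> {0<..} \<Longrightarrow> convergent (\<lambda>n. G (k1 n) r)"
  proof (rule helly_selection_antimono[of "{0<..}" G "\<lambda>r. (of_int m * r powr (- of_int m) * 1) powr (1 / p)"])
    show "\<bar>G n r\<bar> \<le> (of_int m * r powr (- of_int m) * 1) powr (1 / p)" if "r \<in> {0<..}" for n r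
      using antimono_Lp_pointwise_bound[OF dim _ G(1) G_mono, of r n] p that G0[of r n] by (simp add: G_int)
    show "is_interval {0::real<..}" by (auto simp: is_interval_1)
  qed (use G_mono in auto)
  obtain k2 :: "nat \<Rightarrow> nat" where k2: "strict_mono k2" "AE x in \<sigma>. convergent (\<lambda>n. T (G (k1 (k2 n))) x)"
    using T_antimono_sequence_AE_convergent_subsequence[of "\<lambda>n. G (k1 n)" "A powr q"] G(1) G0 G_mono TG_bd by blast
  define k where "k = k1 \<circ> k2"
  have k: "strict_mono k" using k1 k2 by (simp add: k_def strict_mono_o)
  define g where "g r = lim (\<lambda>n. G (k n) r)" for r
  have g: "(\<lambda>n. G (k n) r) \<longlonglongrightarrow> g r" if "0 < r" for r
    using convergent_subseq_convergent[OF k1(2) k2(1), of r] that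
    by (simp add: g_def k_def o_def convergent_LIMSEQ_iff)
  have g_mono: "antimono_on {0<..} g"
  proof (rule monotone_onI)
    fix r s :: real assume rs: "r \<in> {0<..}" "s \<in> {0<..}" "r \<le> s"
    show "g s \<le> g r"
      using rs G_mono by (intro LIMSEQ_le[OF g g]) (auto simp: monotone_on_def)
  qed
  have [measurable]: "G n \<in> borel_measurable \<mu>" for n using G(1)[of n] by (simp add: Lp_space_def)
  have g_meas[measurable]: "g \<in> borel_measurable \<mu>" unfolding g_def by measurable
  have "(\<integral>\<^sup>+x. ennreal (\<bar>g x\<bar> powr p) \<partial>\<mu>) = (\<integral>\<^sup>+x. liminf (\<lambda>n. ennreal (\<bar>G (k n) x\<bar> powr p)) \<partial>\<mu>)"
  proof (rule nn_integral_cong)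
    fix x assume "x \<in> space \<mu>"
    hence "0 < x" by simp
    have "(\<lambda>n. ennreal (\<bar>G (k n) x\<bar> powr p)) \<longlonglongrightarrow> ennreal (\<bar>g x\<bar> powr p)"
      using p g[OF \<open>0 < x\<close>] by (intro tendsto_ennrealI tendsto_powr2 tendsto_rabs) auto
    from lim_imp_Liminf[OF _ this]
    show "ennreal (\<bar>g x\<bar> powr p) = liminf (\<lambda>n. ennreal (\<bar>G (k n) x\<bar> powr p))" by simp
  qed
  also have "\<dots> \<le> liminf (\<lambda>n. \<integral>\<^sup>+x. ennreal (\<bar>G (k n) x\<bar> powr p) \<partial>\<mu>)" by (rule nn_integral_liminf) measurable
  also have "\<dots> = 1" using nn_integral_eq_integral_Lp[OF G(1)] by (simp add: G_int Liminf_const)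
  finally have g_Lp: "g \<in> Lp_space \<mu> p"
    by (auto simp: Lp_space_iff_nn_integral intro: le_less_trans)
  have g1: "\<kappa> \<le> g 1"
  proof (rule LIMSEQ_le_const[OF g])
    show "\<exists>N. \<forall>n\<ge>N. \<kappa> \<le> G (k n) 1"
      using G1 seq_suble[OF k] by (intro exI[of _ N]) (auto intro: order_trans less_imp_le)
  qed simp
  define a where "a = (\<integral>x. \<bar>g x\<bar> powr p \<partial>\<mu>)"
  have "0 < a"
  proof (rule ccontr)
    assume "\<not> 0 < a"
    moreover have "0 \<le> a" by (simp add: a_def)
    ultimately have "a = 0" by simp
    hence "g 1 \<le> 0" using antimono_Lp_pointwise_bound[OF dim _ g_Lp g_mono, of 1] p by (simp add: a_def)
    thus False using g1 \<kappa>(1) by simp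
  qed
  \<comment> \<open>The remainder, in the shape to which linearity applies.\<close>
  define u where "u n = (\<lambda>x. 1 * G (k n) x + (-1) * g x)" for n
  have u_Lp: "u n \<in> Lp_space \<mu> p" for n unfolding u_def by (rule Lp_space_lincomb[OF p G(1) g_Lp])
  have u_ae: "AE x in \<mu>. (\<lambda>n. u n x) \<longlonglongrightarrow> 0"
  proof (rule AE_I2)
    fix x assume "x \<in> space \<mu>"
    hence "(\<lambda>n. G (k n) x - g x) \<longlonglongrightarrow> g x - g x" by (intro tendsto_intros g) simp
    thus "(\<lambda>n. u n x) \<longlonglongrightarrow> 0" by (simp add: u_def)
  qed
  define B where "B = (1 - 1/2) powr (1 - p) * 1 + (1/2) powr (1 - p) * a"
  have u_bd: "(\<integral>x. \<bar>u n x\<bar> powr p \<partial>\<mu>) \<le> B" for n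
  proof -
    have "(\<integral>x. \<bar>u n x\<bar> powr p \<partial>\<mu>)
        \<le> (\<integral>x. (1 - 1/2) powr (1 - p) * \<bar>G (k n) x\<bar> powr p + (1/2) powr (1 - p) * \<bar>g x\<bar> powr p \<partial>\<mu>)"
      using u_Lp[of n] G(1)[of "k n"] g_Lp powr_abs_add_le[OF p, of "1/2" "G (k n) _" "- g _"]
      by (intro integral_mono) (auto simp: Lp_space_def u_def)
    also have "\<dots> = B" using G(1)[of "k n"] g_Lp by (simp add: Lp_space_def B_def G_int a_def)
    finally show ?thesis .
  qed
  have Tu: "AE x in \<sigma>. \<forall>n. T (u n) x = T (G (k n)) x - T g x"
  proof -
    have "AE x in \<sigma>. \<forall>n. T (u n) x = 1 * T (G (k n)) x + (-1) * T g x"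
      unfolding AE_all_countable u_def by (intro allI T_lincomb G g_Lp)
    thus ?thesis by simp
  qed
  have [measurable]: "T (G n) \<in> borel_measurable \<sigma>" "T g \<in> borel_measurable \<sigma>" for n
    using T_Lp[OF G(1)[of n]] T_Lp[OF g_Lp] by (auto simp: Lp_space_def)
  \<comment> \<open>Shown to vanish: the limit of the images is the image of the limit.\<close>
  define w where "w x = lim (\<lambda>n. T (G (k n)) x) - T g x" for x
  have [measurable]: "w \<in> borel_measurable \<sigma>" unfolding w_def by measurable
  have Tu_w: "AE x in \<sigma>. (\<lambda>n. T (u n) x) \<longlonglongrightarrow> w x" using Tu k2(2)
  proof eventually_elim
    case (elim x)
    have "(\<lambda>n. T (G (k n)) x - T g x) \<longlonglongrightarrow> w x" unfolding w_def
      using elim(2) by (intro tendsto_diff tendsto_const) (simp add: k_def convergent_LIMSEQ_iff)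
    thus ?case using elim(1) by simp
  qed
  have "AE x in \<sigma>. w x = 0"
    using q by (intro image_limit_of_null_sequence[OF p _ Lp_op u_Lp u_ae u_bd _ Tu_w]) auto
  with Tu_w have Tu_ae: "AE x in \<sigma>. (\<lambda>n. T (u n) x) \<longlonglongrightarrow> 0" by eventually_elim auto
  have Tu_le: "(\<integral>x. \<bar>T (u n) x\<bar> powr q \<partial>\<sigma>) \<le> A powr q * (\<integral>x. \<bar>u n x\<bar> powr p \<partial>\<mu>) powr (q / p)" for n
    by (rule T_integral_le[OF u_Lp])
  have Tu_bd: "(\<integral>x. \<bar>T (u n) x\<bar> powr q \<partial>\<sigma>) \<le> A powr q * B powr (q / p)" for n
    using Tu_le[of n] by (rule order_trans) (use u_bd p q in \<open>intro mult_left_mono powr_mono2, auto\<close>)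
  have "(\<lambda>n. (\<integral>x. \<bar>g x + u n x\<bar> powr p \<partial>\<mu>) - (\<integral>x. \<bar>u n x\<bar> powr p \<partial>\<mu>)) \<longlonglongrightarrow> a"
    unfolding a_def by (rule brezis_lieb[OF p g_Lp u_Lp u_ae u_bd])
  hence "(\<lambda>n. 1 - (\<integral>x. \<bar>u n x\<bar> powr p \<partial>\<mu>)) \<longlonglongrightarrow> a" by (simp add: u_def G_int)
  hence "(\<lambda>n. 1 - (1 - (\<integral>x. \<bar>u n x\<bar> powr p \<partial>\<mu>))) \<longlonglongrightarrow> 1 - a" by (intro tendsto_diff tendsto_const)
  hence u_lim: "(\<lambda>n. (\<integral>x. \<bar>u n x\<bar> powr p \<partial>\<mu>)) \<longlonglongrightarrow> 1 - a" by simp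
  have "0 \<le> 1 - a" by (rule LIMSEQ_le_const[OF u_lim]) auto
  define b where "b = (\<integral>x. \<bar>T g x\<bar> powr q \<partial>\<sigma>)"
  have "(\<lambda>n. (\<integral>x. \<bar>T g x + T (u n) x\<bar> powr q \<partial>\<sigma>) - (\<integral>x. \<bar>T (u n) x\<bar> powr q \<partial>\<sigma>)) \<longlonglongrightarrow> b"
    unfolding b_def by (rule brezis_lieb[OF q T_Lp[OF g_Lp] T_Lp[OF u_Lp] Tu_ae Tu_bd])
  moreover have "(\<integral>x. \<bar>T g x + T (u n) x\<bar> powr q \<partial>\<sigma>) = Lp_norm \<sigma> q (T (F (k n))) powr q" for n
  proof -
    have [measurable]: "T (u n) \<in> borel_measurable \<sigma>" using T_Lp[OF u_Lp[of n]] by (auto simp: Lp_space_def)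
    have "(\<integral>x. \<bar>T g x + T (u n) x\<bar> powr q \<partial>\<sigma>) = (\<integral>x. \<bar>T (G (k n)) x\<bar> powr q \<partial>\<sigma>)"
      using Tu by (intro integral_cong_AE) (auto elim!: eventually_mono)
    thus ?thesis by (simp add: TG_int)
  qed
  ultimately have "(\<lambda>n. Lp_norm \<sigma> q (T (F (k n))) powr q - (\<integral>x. \<bar>T (u n) x\<bar> powr q \<partial>\<sigma>)) \<longlonglongrightarrow> b" by simp
  moreover have TF_lim: "(\<lambda>n. Lp_norm \<sigma> q (T (F (k n))) powr q) \<longlonglongrightarrow> A powr q"
    using LIMSEQ_subseq_LIMSEQ[OF lim k] A by (intro tendsto_intros) (auto simp: o_def)
  ultimately have "(\<lambda>n. Lp_norm \<sigma> q (T (F (k n))) powr q -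
      (Lp_norm \<sigma> q (T (F (k n))) powr q - (\<integral>x. \<bar>T (u n) x\<bar> powr q \<partial>\<sigma>))) \<longlonglongrightarrow> A powr q - b"
    by (intro tendsto_diff)
  hence Tu_lim: "(\<lambda>n. (\<integral>x. \<bar>T (u n) x\<bar> powr q \<partial>\<sigma>)) \<longlonglongrightarrow> A powr q - b" by simp
  have "(\<lambda>n. A powr q * (\<integral>x. \<bar>u n x\<bar> powr p \<partial>\<mu>) powr (q / p)) \<longlonglongrightarrow> A powr q * (1 - a) powr (q / p)"
    using p q by (intro tendsto_mult tendsto_const tendsto_powr2 u_lim) auto
  hence "A powr q - b \<le> A powr q * (1 - a) powr (q / p)"
    using Tu_le by (intro LIMSEQ_le[OF Tu_lim]) auto
  moreover have b_le: "b \<le> A powr q * a powr (q / p)" unfolding a_def b_def by (rule T_integral_le[OF g_Lp])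
  ultimately have "A powr q * 1 \<le> A powr q * (a powr (q / p) + (1 - a) powr (q / p))"
    by (simp add: distrib_left)
  hence "1 \<le> a powr (q / p) + (1 - a) powr (q / p)" using A by (subst (asm) mult_le_cancel_left_pos) auto
  hence "\<not> a < 1" using powr_sum_less_one[of a "q / p"] \<open>0 < a\<close> p pq by auto
  hence a: "a = 1" using \<open>0 \<le> 1 - a\<close> by simp
  have "A powr q - b \<le> 0" using \<open>A powr q - b \<le> A powr q * (1 - a) powr (q / p)\<close> a by simp
  hence b: "b = A powr q" using b_le a by simp
  have "Lp_norm \<mu> p g = 1" using a by (simp add: Lp_norm_def a_def)
  moreover have "Lp_norm \<sigma> q (T g) = A" using b q A by (simp add: Lp_norm_def b_def powr_powr)
  moreover have "(\<lambda>n. Lp_norm \<mu> p (\<lambda>r. dilation m p (c (k n)) (F (k n)) r - g r)) \<longlonglongrightarrow> 0"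
  proof -
    have "(\<lambda>n. (\<integral>x. \<bar>u n x\<bar> powr p \<partial>\<mu>) powr (1 / p)) \<longlonglongrightarrow> (1 - a) powr (1 / p)"
      using p by (intro tendsto_powr2 tendsto_const u_lim) auto
    thus ?thesis using a by (simp add: Lp_norm_def u_def G_def)
  qed
  ultimately show ?thesis by (intro that[of c k g] c(1) k g_Lp g_mono)
qed

text \<open>Rearrangement preserves the norm and does not decrease the norm of the image, so it turns any
  extremizing sequence into one of decreasing functions.\<close>

lemma extremizing_antimono_sequence_exists:
  assumes A: "0 < A"
    and rearr: "\<forall>f \<in> Lp_space \<mu> p. \<exists>g. nonincr_rearrangement m f g \<and> Lp_norm \<sigma> q (T f) \<le> Lp_norm \<sigma> q (T g)"
  obtains F where "\<And>n. F n \<in> Lp_space \<mu> p" "\<And>n. Lp_norm \<mu> p (F n) = 1" "\<And>n. antimono_on {0<..} (F n)"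
    "(\<lambda>n. Lp_norm \<sigma> q (T (F n))) \<longlonglongrightarrow> A"
proof -
  have ex: "\<exists>g. g \<in> Lp_space \<mu> p \<and> Lp_norm \<mu> p g = 1 \<and> antimono_on {0<..} g \<and> B < Lp_norm \<sigma> q (T g)"
    if B: "0 \<le> B" "B < A" for B
  proof -
    have "B \<notin> admissible_consts" using A_le[of B] B by auto
    then obtain f where f: "f \<in> Lp_space \<mu> p" "B * Lp_norm \<mu> p f < Lp_norm \<sigma> q (T f)"
      using B by (auto simp: admissible_consts_def not_le)
    define L where "L = Lp_norm \<mu> p f"
    have "L \<noteq> 0" using f T_norm_le[OF f(1)] by (auto simp: L_def)
    hence L: "0 < L" using Lp_norm_nonneg[of \<mu> p f] unfolding L_def by linarith
    \<comment> \<open>Normalization, written as a linear combination of two functions as in the definition of linearity.\<close>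
    define f' where "f' = (\<lambda>r. 1 / L * f r + 0 * f r)"
    have f': "f' \<in> Lp_space \<mu> p" unfolding f'_def using p f by (intro Lp_space_lincomb) auto
    have "Lp_norm \<mu> p f' = 1 / L * L"
    proof -
      have "(\<integral>x. \<bar>f' x\<bar> powr p \<partial>\<mu>) = (\<integral>x. (1 / L) powr p * \<bar>f x\<bar> powr p \<partial>\<mu>)"
        using L by (intro Bochner_Integration.integral_cong) (auto simp: f'_def abs_mult powr_mult[symmetric])
      thus ?thesis using L p by (simp add: Lp_norm_def powr_mult powr_powr L_def)
    qed
    hence n1: "Lp_norm \<mu> p f' = 1" using L by simp
    have "Lp_norm \<sigma> q (T f') = 1 / L * Lp_norm \<sigma> q (T f)"
    proof -
      have [measurable]: "T f \<in> borel_measurable \<sigma>" "T f' \<in> borel_measurable \<sigma>"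
        using T_Lp f f' by (auto simp: Lp_space_def)
      have "AE x in \<sigma>. T f' x = 1 / L * T f x + 0 * T f x" unfolding f'_def using f by (intro T_lincomb)
      hence "(\<integral>x. \<bar>T f' x\<bar> powr q \<partial>\<sigma>) = (\<integral>x. (1 / L) powr q * \<bar>T f x\<bar> powr q \<partial>\<sigma>)"
        using L by (intro integral_cong_AE) (auto elim!: eventually_mono simp: abs_mult powr_mult[symmetric])
      thus ?thesis using L q by (simp add: Lp_norm_def powr_mult powr_powr)
    qed
    hence "L * Lp_norm \<sigma> q (T f') = Lp_norm \<sigma> q (T f)" using L by simp
    hence "L * B < L * Lp_norm \<sigma> q (T f')" using f(2) by (simp add: L_def mult.commute)
    hence "B < Lp_norm \<sigma> q (T f')" using L by simp
    moreover obtain g where g: "nonincr_rearrangement m f' g" "Lp_norm \<sigma> q (T f') \<le> Lp_norm \<sigma> q (T g)"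
      using rearr f' by blast
    ultimately show ?thesis using rearrangement_Lp[OF _ f' g(1)] p n1
      by (intro exI[of _ g]) (auto simp: nonincr_rearrangement_def)
  qed
  define B where "B n = A * (1 - 1 / real (n + 1))" for n
  have "\<exists>g. g \<in> Lp_space \<mu> p \<and> Lp_norm \<mu> p g = 1 \<and> antimono_on {0<..} g \<and> B n < Lp_norm \<sigma> q (T g)" for n
    using A by (intro ex) (auto simp: B_def field_simps)
  then obtain F where F: "\<And>n. F n \<in> Lp_space \<mu> p" "\<And>n. Lp_norm \<mu> p (F n) = 1" "\<And>n. antimono_on {0<..} (F n)"
    "\<And>n. B n < Lp_norm \<sigma> q (T (F n))" by metis
  have "(\<lambda>n. Lp_norm \<sigma> q (T (F n))) \<longlonglongrightarrow> A"
  proof (rule tendsto_sandwich)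
    show "eventually (\<lambda>n. B n \<le> Lp_norm \<sigma> q (T (F n))) sequentially"
      by (intro always_eventually allI less_imp_le F)
    show "eventually (\<lambda>n. Lp_norm \<sigma> q (T (F n)) \<le> A) sequentially"
      using T_norm_le[OF F(1)] F(2) by auto
    have "(\<lambda>n. A * (1 - 1 / real (n + 1))) \<longlonglongrightarrow> A * (1 - 0)"
      using LIMSEQ_inverse_real_of_nat by (intro tendsto_intros) (simp add: inverse_eq_divide)
    thus "B \<longlonglongrightarrow> A" unfolding B_def[abs_def] by simp
  qed simp
  with F show ?thesis using that by blast
qed

text \<open>With \<open>A = 0\<close> all images vanish almost everywhere, so any nonzero decreasing function will do.\<close>

lemma extremizer_of_zero_operator:
  assumes A: "A = 0"
  shows "\<exists>f. antimono_on {0<..} f \<and> extremizer m p \<sigma> q T f"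
proof -
  define f :: "real \<Rightarrow> real" where "f = indicator {0<..1}"
  have S: "{0<..1} \<in> sets \<mu>" by (auto simp: sets_restrict_space_iff)
  have "(\<integral>\<^sup>+r. ennreal (\<bar>f r\<bar> powr p) \<partial>\<mu>) = (\<integral>\<^sup>+r. indicator {0<..1} r \<partial>\<mu>)"
    by (intro nn_integral_cong) (auto simp: f_def indicator_def)
  also have "\<dots> = ennreal (1 / of_int m)" using S emeasure_radial_Ioc[OF dim, of 1] by simp
  finally have I: "(\<integral>\<^sup>+r. ennreal (\<bar>f r\<bar> powr p) \<partial>\<mu>) = ennreal (1 / of_int m)" .
  have f: "f \<in> Lp_space \<mu> p" using S I by (simp add: Lp_space_iff_nn_integral f_def)
  have "\<not> (AE r in \<mu>. f r = 0)"
  proof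
    assume "AE r in \<mu>. f r = 0"
    hence "AE r in \<mu>. ennreal (\<bar>f r\<bar> powr p) = 0" by eventually_elim simp
    hence "(\<integral>\<^sup>+r. ennreal (\<bar>f r\<bar> powr p) \<partial>\<mu>) = (\<integral>\<^sup>+r. 0 \<partial>\<mu>)" by (rule nn_integral_cong_AE)
    thus False using I dim by simp
  qed
  moreover have "Lp_norm \<sigma> q (T f) = A * Lp_norm \<mu> p f"
    using T_norm_le[OF f] A by (simp add: antisym)
  moreover have "antimono_on {0<..} f" by (auto simp: monotone_on_def f_def indicator_def)
  ultimately show ?thesis using f by (auto simp: extremizer_def)
qed

end

theorem theorem1p2:
  fixes m :: int and p q \<delta> :: real and \<sigma> :: "real measure"
    and T :: "(real \<Rightarrow> real) \<Rightarrow> real \<Rightarrow> real"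
  assumes "sets \<sigma> = sets (restrict_space borel {0..})"
    and "emeasure \<sigma> {0} = 0"
    and "1 < p" and "p < q" and "0 < \<delta>" and "p + \<delta> < q - \<delta>"
    and "bounded_linear_op
           (Lp_space (radial_measure m) p) (Lp_norm (radial_measure m) p)
           (Lp_space \<sigma> q) (Lp_norm \<sigma> q) \<sigma> T"
    and "bounded_linear_op
           (lorentz_space (radial_measure m) p (p + \<delta>)) (lorentz_norm (radial_measure m) p (p + \<delta>))
           (lorentz_space \<sigma> q (q - \<delta>)) (lorentz_norm \<sigma> q (q - \<delta>)) \<sigma> T"
    and "\<forall>f \<in> Lp_space (radial_measure m) p.
           \<exists>g. nonincr_rearrangement m f g \<and> Lp_norm \<sigma> q (T f) \<le> Lp_norm \<sigma> q (T g)"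
    and "\<forall>f \<in> Lp_space (radial_measure m) p.
           (\<forall>r>0. 0 \<le> f r) \<and> antimono_on {0<..} f \<longrightarrow>
           (\<exists>h. antimono_on {0<..} h \<and> (AE x in \<sigma>. T f x = h x))"
    and "\<forall>c>0. \<forall>f \<in> Lp_space (radial_measure m) p.
           Lp_norm \<sigma> q (T (dilation m p c f)) = Lp_norm \<sigma> q (T f)"
  shows "(\<exists>f. antimono_on {0<..} f \<and> extremizer m p \<sigma> q T f) \<and>
         (0 < optimal_const m p \<sigma> q T \<longrightarrow>
           (\<forall>F. extremizing_sequence m p \<sigma> q T F \<and> (\<forall>n. antimono_on {0<..} (F n)) \<longrightarrow>
              rel_compact_mod_dilations m p F))"
proof -
  have "1 \<le> m" using assms(9) by (intro dimension_ge_one) blast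
  then interpret dilation_invariant_operator m p q \<delta> \<sigma> T
    using assms by unfold_locales blast+
  show ?thesis
  proof (intro conjI impI allI)
    show "\<exists>f. antimono_on {0<..} f \<and> extremizer m p \<sigma> q T f"
    proof (cases "A = 0")
      case False
      hence A: "0 < A" using A_nonneg by simp
      obtain F where F: "\<And>n. F n \<in> Lp_space \<mu> p" "\<And>n. Lp_norm \<mu> p (F n) = 1" "\<And>n. antimono_on {0<..} (F n)"
        "(\<lambda>n. Lp_norm \<sigma> q (T (F n))) \<longlonglongrightarrow> A"
        by (rule extremizing_antimono_sequence_exists[OF A assms(9)]) (rule that)
      obtain c k g where "\<And>n. 0 < c n" "strict_mono (k :: nat \<Rightarrow> nat)" and g: "g \<in> Lp_space \<mu> p"
        "antimono_on {0<..} g" "Lp_norm \<mu> p g = 1" "Lp_norm \<sigma> q (T g) = A"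
        and "(\<lambda>n. Lp_norm \<mu> p (\<lambda>r. dilation m p (c (k n)) (F (k n)) r - g r)) \<longlonglongrightarrow> 0"
        by (rule extremizing_antimono_sequence_compact[OF A F]) (rule that)
      have "\<not> (AE r in \<mu>. g r = 0)"
      proof
        assume "AE r in \<mu>. g r = 0"
        hence "AE r in \<mu>. \<bar>g r\<bar> powr p = 0" by eventually_elim simp
        hence "Lp_norm \<mu> p g = 0" by (simp add: Lp_norm_def integral_eq_zero_AE)
        thus False using g(3) by simp
      qed
      thus ?thesis using g by (auto simp: extremizer_def)
    qed (rule extremizer_of_zero_operator)
  next
    fix F assume A: "0 < A" and F: "extremizing_sequence m p \<sigma> q T F \<and> (\<forall>n. antimono_on {0<..} (F n))"
    hence F': "\<And>n. F n \<in> Lp_space \<mu> p" "\<And>n. Lp_norm \<mu> p (F n) = 1" "\<And>n. antimono_on {0<..} (F n)"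
      "(\<lambda>n. Lp_norm \<sigma> q (T (F n))) \<longlonglongrightarrow> A" by (auto simp: extremizing_sequence_def)
    obtain c k g where c: "\<And>n. 0 < c n" and kg: "strict_mono (k :: nat \<Rightarrow> nat)" "g \<in> Lp_space \<mu> p"
      and "antimono_on {0<..} g" "Lp_norm \<mu> p g = 1" "Lp_norm \<sigma> q (T g) = A"
      and lim: "(\<lambda>n. Lp_norm \<mu> p (\<lambda>r. dilation m p (c (k n)) (F (k n)) r - g r)) \<longlonglongrightarrow> 0"
      by (rule extremizing_antimono_sequence_compact[OF A F']) (rule that)
    show "rel_compact_mod_dilations m p F" unfolding rel_compact_mod_dilations_def
      using c kg lim by (intro exI[of _ c] exI[of _ k] exI[of _ g] conjI allI)
  qed
qed

end
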